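(* Let $\Delta=\{(s,t): 0\le s\le t<\infty\}$. (1) Let $(k_{s,t})_{(s,t)\in\Delta}$ be a family of transition kernels of a branching process on $[0,\infty]$. For $(s,t)\in\Delta$ let $v_{s,t}$ be the Laplace exponent of $k_{s,t}$, i.e. the (unique) Bernstein function with $$\int_{[0,\infty)} e^{-\theta y}\,k_{s,t}(x,\mathrm{d}y)=e^{-x v_{s,t}(\theta)}\qquad\text{for all }x,\theta\in(0,\infty),$$ extended holomorphically to $\mathbb{H}=\{\zeta\in\mathbb{C}:\operatorname{Re}\zeta>0\}$. Then $(v_{s,t})_{(s,t)\in\Delta}$ is a topological reverse evolution family in $\mathbb{H}$ contained in $\mathcal{BF}$. (2) Conversely, given a topological reverse evolution family $(v_{s,t})_{(s,t)\in\Delta}$ in $\mathbb{H}$ contained in $\mathcal{BF}$, there exists a unique family of transition kernels $(k_{s,t})_{(s,t)\in\Delta}$ of a branching process on $[0,\infty]$ such that $\int_{[0,\infty)} e^{-\theta y}\,k_{s,t}(x,\mathrm{d}y)=e^{-x v_{s,t}(\theta)}$ for all $(s,t)\in\Delta$ and $x,\theta\in(0,\infty)$.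
   Context: A transition kernel on a Polish space $S$ is a map $k:S\times\mathcal{B}(S)\to[0,1]$ with $k(x,\cdot)$ a Borel probability measure for each $x$ and $x\mapsto k(x,B)$ Borel measurable for each Borel $B$. Composition: $(k\star l)(x,B)=\int_S l(y,B)\,k(x,\mathrm{d}y)$. A family of transition kernels $(k_{s,t})_{(s,t)\in\Delta}$ on $[0,\infty]$ (a compact space) is called a family of transition kernels of a branching process if: (K1) $k_{s,s}(x,\cdot)=\delta_x$ for all $s\ge0$, $x\in[0,\infty]$; (K2) $k_{s,t}\star k_{t,u}=k_{s,u}$ for $0\le s\le t\le u$; (K3) the map $\Delta\times[0,\infty)\ni(s,t,x)\mapsto k_{s,t}(x,\cdot)$ is weakly continuous into probability measures on $[0,\infty]$; (K4) $k_{s,t}(x,\cdot)\ast k_{s,t}(y,\cdot)=k_{s,t}(x+y,\cdot)$ for $(s,t)\in\Delta$, $x,y\in[0,\infty)$ ($\ast$ = convolution); (K5) $k_{s,t}(0,\cdot)=\delta_0$; (K6) $k_{s,t}(\infty,\cdot)=\delta_\infty$. A Bernstein function is a $C^\infty$ function $f:(0,\infty)\to\mathbb{R}$ with $f\ge0$ and $(-1)^{n-1}f^{(n)}\ge0$ for all $n\in\mathbb{N}$; equivalently $f(\theta)=\alpha+\beta\theta+\int_{(0,\infty)}(1-e^{-\theta x})\tau(\mathrm{d}x)$ with $\alpha,\beta\ge0$ and $\tau$ a nonnegative Borel measure with $\int\min\{1,x\}\tau(\mathrm{d}x)<\infty$. Each Bernstein function extends holomorphically to $\mathbb{H}$ via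 this formula; $\mathcal{BF}$ denotes the set of Bernstein functions not identically zero, regarded as holomorphic self-maps of $\mathbb{H}$. For a simply connected domain $D\subsetneq\mathbb{C}$, ${\sf Hol}(D,D)$ carries the topology of locally uniform convergence. A topological reverse evolution family in $D$ is a family $(v_{s,t})_{(s,t)\in\Delta}\subset{\sf Hol}(D,D)$ with $v_{s,s}={\rm id}_D$ for all $s\ge0$, $v_{s,u}=v_{s,t}\circ v_{t,u}$ for $0\le s\le t\le u$, and $\Delta\ni(s,t)\mapsto v_{s,t}\in{\sf Hol}(D,D)$ continuous. It is contained in a set $\mathfrak U$ if all $v_{s,t}\in\mathfrak U$. *)

theory Defs
  imports "HOL-Probability.Probability"
begin

text \<open>The state space [0,\<infinity>] is the type ennreal with its Borel sigma algebra
  (order topology = usual compact topology of [0,\<infinity>]).\<close>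

definition Delta :: "(real \<times> real) set" where
  "Delta = {(s, t). 0 \<le> s \<and> s \<le> t}"

definition transition_kernel :: "(ennreal \<Rightarrow> ennreal measure) \<Rightarrow> bool" where
  "transition_kernel k \<longleftrightarrow>
     (\<forall>x. prob_space (k x) \<and> sets (k x) = sets (borel :: ennreal measure)) \<and>
     (\<forall>B \<in> sets (borel :: ennreal measure). (\<lambda>x. emeasure (k x) B) \<in> borel_measurable borel)"

definition conv_ennreal :: "ennreal measure \<Rightarrow> ennreal measure \<Rightarrow> ennreal measure" where
  "conv_ennreal M N = distr (M \<Otimes>\<^sub>M N) borel (\<lambda>(a, b). a + b)"

definition branching_kernels :: "(real \<Rightarrow> real \<Rightarrow> ennreal \<Rightarrow> ennreal measure) \<Rightarrow> bool" where
  "branching_kernels k \<longleftrightarrow>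
     (\<forall>(s, t) \<in> Delta. transition_kernel (k s t)) \<and>
     \<comment> \<open>(K1)\<close>
     (\<forall>s x. 0 \<le> s \<longrightarrow> k s s x = return borel x) \<and>
     \<comment> \<open>(K2)\<close>
     (\<forall>s t u x. 0 \<le> s \<and> s \<le> t \<and> t \<le> u \<longrightarrow>
        (\<forall>B \<in> sets (borel :: ennreal measure).
           emeasure (k s u x) B = (\<integral>\<^sup>+ y. emeasure (k t u y) B \<partial>(k s t x)))) \<and>
     \<comment> \<open>(K3) weak continuity on Delta \<times> [0,\<infinity>)\<close>
     (\<forall>f :: ennreal \<Rightarrow> real. continuous_on UNIV f \<longrightarrow>
        continuous_on {(s, t, x). (s, t) \<in> Delta \<and> x \<noteq> \<top>}
          (\<lambda>(s, t, x). \<integral> y. f y \<partial>(k s t x))) \<and>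
     \<comment> \<open>(K4)\<close>
     (\<forall>(s, t) \<in> Delta. \<forall>x y. x \<noteq> \<top> \<and> y \<noteq> \<top> \<longrightarrow>
        conv_ennreal (k s t x) (k s t y) = k s t (x + y)) \<and>
     \<comment> \<open>(K5), (K6)\<close>
     (\<forall>(s, t) \<in> Delta. k s t 0 = return borel 0) \<and>
     (\<forall>(s, t) \<in> Delta. k s t \<top> = return borel \<top>)"

definition RHP :: "complex set" where
  "RHP = {z. Re z > 0}"

definition bernstein_function :: "(real \<Rightarrow> real) \<Rightarrow> bool" where
  "bernstein_function f \<longleftrightarrow>
     (\<forall>n. \<forall>x > 0. ((deriv ^^ n) f has_real_derivative (deriv ^^ Suc n) f x) (at x)) \<and>
     (\<forall>x > 0. f x \<ge> 0) \<and>
     (\<forall>n \<ge> 1. \<forall>x > 0. (-1) ^ (n - 1) * (deriv ^^ n) f x \<ge> 0)"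

text \<open>v is the holomorphic extension to RHP of a Bernstein function (unique by the
  identity theorem, so "holomorphic on RHP and equal to f on (0,\<infinity>)" characterises it).\<close>
definition ext_bernstein :: "(complex \<Rightarrow> complex) \<Rightarrow> bool" where
  "ext_bernstein v \<longleftrightarrow> v holomorphic_on RHP \<and>
     (\<exists>f. bernstein_function f \<and> (\<forall>x > 0. v (complex_of_real x) = complex_of_real (f x)))"

definition BF :: "(complex \<Rightarrow> complex) set" where
  "BF = {v. v holomorphic_on RHP \<and>
     (\<exists>f. bernstein_function f \<and> (\<exists>x > 0. f x \<noteq> 0) \<and>
          (\<forall>x > 0. v (complex_of_real x) = complex_of_real (f x)))}"

text \<open>Continuity of a parametrised family into Hol(D,D) with the topology of
  locally uniform convergence.\<close>
definition lu_continuous_on ::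
    "(real \<times> real) set \<Rightarrow> complex set \<Rightarrow> (real \<Rightarrow> real \<Rightarrow> complex \<Rightarrow> complex) \<Rightarrow> bool" where
  "lu_continuous_on P D v \<longleftrightarrow>
     (\<forall>(s, t) \<in> P. \<forall>K. compact K \<and> K \<subseteq> D \<longrightarrow>
        (\<forall>\<epsilon> > 0. \<exists>\<delta> > 0. \<forall>(s', t') \<in> P. dist (s', t') (s, t) < \<delta> \<longrightarrow>
            (\<forall>z \<in> K. dist (v s' t' z) (v s t z) < \<epsilon>)))"

definition top_rev_evolution_family ::
    "complex set \<Rightarrow> (real \<Rightarrow> real \<Rightarrow> complex \<Rightarrow> complex) \<Rightarrow> bool" where
  "top_rev_evolution_family D v \<longleftrightarrow>
     (\<forall>(s, t) \<in> Delta. v s t holomorphic_on D \<and> v s t ` D \<subseteq> D) \<and>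
     (\<forall>s z. 0 \<le> s \<and> z \<in> D \<longrightarrow> v s s z = z) \<and>
     (\<forall>s t u z. 0 \<le> s \<and> s \<le> t \<and> t \<le> u \<and> z \<in> D \<longrightarrow> v s u z = v s t (v t u z)) \<and>
     lu_continuous_on Delta D v"

definition laplace_relation ::
    "(real \<Rightarrow> real \<Rightarrow> ennreal \<Rightarrow> ennreal measure) \<Rightarrow> (real \<Rightarrow> real \<Rightarrow> complex \<Rightarrow> complex) \<Rightarrow> bool" where
  "laplace_relation k v \<longleftrightarrow>
     (\<forall>(s, t) \<in> Delta. \<forall>x \<theta>. x > 0 \<and> \<theta> > 0 \<longrightarrow>
        complex_of_real (\<integral> y. indicator {..<\<top>} y * exp (- \<theta> * enn2real y) \<partial>(k s t (ennreal x)))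
          = exp (- complex_of_real x * v s t (complex_of_real \<theta>)))"

end

theory Submission
  imports Defs "HOL-Real_Asymp.Real_Asymp" "HOL-Complex_Analysis.Complex_Analysis"
begin

text \<open>
  The substitution u = exp (-y) identifies [0,\<infinity>] with [0,1] and turns Laplace transforms at
  integers into moments. Hence a probability measure on [0,\<infinity>] is determined by its Laplace
  transform (Weierstrass), weak continuity can be tested on Laplace transforms, and the measure with
  transform exp (-x f) for a Bernstein function f is obtained by solving a Hausdorff moment problem:
  exp (-x f) is completely monotone, and the mass missing at 0 is placed at \<infinity>.
  With these three facts the kernel axioms (K1)-(K6) translate into the axioms of a reverse
  evolution family on the positive half-line. The identity theorem carries these identities to the
  right half-plane, and continuity is carried over by a Lipschitz bound for Laplace transforms that
  is uniform over all probability measures.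
\<close>

section \<open>Hausdorff moments and complete monotonicity\<close>

text \<open>Three obstacles shape the proof. In (1) an exponent is only assumed to be Bernstein,
  possibly zero, and the transforms constrain it only at positive arguments, so composition makes
  sense only where the inner value is positive. Non-degeneracy has to be won first, by a continuity
  argument in time; the self-map property of the half-plane then follows from it. Second, the
  transform for the initial state 1 determines its exponent only modulo 2 \<pi> i, so locally
  uniform convergence must be lifted through a logarithm whose branch is fixed at the point 1, where
  exponents are real. Third, in (2) a moment problem yields the transform at integers alone;
  determinacy of the measure is what carries the formula to rational arguments, and continuity to
  all others. Kernels are then chosen state by state, so their measurability is recovered afterwards
  from continuity in the state.\<close>

text \<open>This is (-1)^k times the k-th forward difference of c at n. If c lists the moments of a
  measure on [0,1], it is the integral of u^n (1-u)^k, hence nonnegative; Hausdorff's condition is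
  the converse.\<close>

fun alt_diff :: "nat \<Rightarrow> (nat \<Rightarrow> real) \<Rightarrow> nat \<Rightarrow> real" where
  "alt_diff 0 c n = c n"
| "alt_diff (Suc k) c n = alt_diff k c n - alt_diff k c (Suc n)"

text \<open>The recursion takes the outermost difference first. Taking the innermost one first lets
  an induction on k replace the sequence itself.\<close>

lemma alt_diff_shift: "alt_diff (Suc k) c n = alt_diff k (\<lambda>n. c n - c (Suc n)) n"
  by (induction k arbitrary: n) auto

lemma alt_diff_upd_0_Suc: "alt_diff k (c(0 := a)) (Suc n) = alt_diff k c (Suc n)"
  by (induction k arbitrary: n) auto

text \<open>The entry \<open>c 0\<close> enters only the differences at index 0, and there with
  coefficient 1. Raising it therefore preserves nonnegativity of all differences, which is how mass
  gets added at u = 0.\<close>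

lemma alt_diff_upd_0: "alt_diff k (c(0 := a)) 0 = alt_diff k c 0 + (a - c 0)"
  by (induction k) (simp_all add: alt_diff_upd_0_Suc del: fun_upd_apply add: fun_upd_same)

lemma tendsto_alt_diff:
  assumes "\<And>n. ((\<lambda>e. c e n) \<longlongrightarrow> d n) F"
  shows "((\<lambda>e. alt_diff k (c e) n) \<longlongrightarrow> alt_diff k d n) F"
  by (induction k arbitrary: n) (auto intro: tendsto_diff assms)

text \<open>For moments this is u^n = u^n (u + (1-u))^r expanded by the binomial theorem. In general
  the recursion plays the role of 1 = u + (1-u), and Pascal's rule joins the two resulting
  sums.\<close>

lemma alt_diff_binomial_expansion:
  "alt_diff 0 c n = (\<Sum>i\<le>r. real (r choose i) * alt_diff (r - i) c (n + i))"
proof (induction r)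
  case 0
  then show ?case by simp
next
  case (Suc r)
  have split: "alt_diff (r - i) c (n + i) = alt_diff (Suc r - i) c (n + i) + alt_diff (r - i) c (n + Suc i)"
    if "i \<le> r" for i
    using that by (simp add: Suc_diff_le)
  have "alt_diff 0 c n = (\<Sum>i\<le>r. real (r choose i) * alt_diff (Suc r - i) c (n + i))
      + (\<Sum>i\<le>r. real (r choose i) * alt_diff (r - i) c (n + Suc i))"
    unfolding Suc.IH sum.distrib[symmetric]
    by (intro sum.cong refl) (simp add: split distrib_left del: alt_diff.simps)
  also have "(\<Sum>i\<le>r. real (r choose i) * alt_diff (Suc r - i) c (n + i))
     = alt_diff (Suc r) c n + (\<Sum>i\<le>r. real (r choose Suc i) * alt_diff (r - i) c (n + Suc i))"
  proof -
    have "(\<Sum>i\<le>r. real (r choose i) * alt_diff (Suc r - i) c (n + i))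
      = (\<Sum>i\<le>Suc r. real (r choose i) * alt_diff (Suc r - i) c (n + i))"
      by simp
    \<comment> \<open>The sum could be extended to \<open>Suc r\<close> because
      \<open>r choose Suc r\<close> is 0; splitting off i = 0 now aligns it with the second
      sum.\<close>
    also have "\<dots> = alt_diff (Suc r) c n + (\<Sum>i\<le>r. real (r choose Suc i) * alt_diff (r - i) c (n + Suc i))"
      by (subst sum.atMost_Suc_shift) (simp del: alt_diff.simps)
    finally show ?thesis .
  qed
  also have "alt_diff (Suc r) c n + (\<Sum>i\<le>r. real (r choose Suc i) * alt_diff (r - i) c (n + Suc i))
      + (\<Sum>i\<le>r. real (r choose i) * alt_diff (r - i) c (n + Suc i))
     = alt_diff (Suc r) c n + (\<Sum>i\<le>r. real (Suc r choose Suc i) * alt_diff (r - i) c (n + Suc i))"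
    by (simp add: sum.distrib[symmetric] distrib_right add.commute del: alt_diff.simps)
  also have "\<dots> = (\<Sum>i\<le>Suc r. real (Suc r choose i) * alt_diff (Suc r - i) c (n + i))"
    by (subst sum.atMost_Suc_shift) (simp del: alt_diff.simps binomial_Suc_Suc)
  finally show ?case .
qed

text \<open>The expansion with r = m - n, reindexed by j = n + i. The identity C(m,j) C(j,n) =
  C(m,n) C(m-n,j-n) makes the weights independent of n, so one discrete distribution on {0..m}
  serves all moments.\<close>

lemma moment_eq_binomial_average:
  assumes "n \<le> m"
  shows "c n = (\<Sum>j\<le>m. real (m choose j) * alt_diff (m - j) c j * (real (j choose n) / real (m choose n)))"
proof -
  have "c n = (\<Sum>i\<le>m - n. real ((m - n) choose i) * alt_diff (m - n - i) c (n + i))"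
    using alt_diff_binomial_expansion[of c n "m - n"] by simp
  also have "\<dots> = (\<Sum>j\<in>{n..m}. real ((m - n) choose (j - n)) * alt_diff (m - j) c j)"
    by (rule sum.reindex_bij_witness[where i="\<lambda>j. j - n" and j="\<lambda>i. n + i"]) (use assms in auto)
  also have "\<dots> = (\<Sum>j\<in>{n..m}. real (m choose j) * alt_diff (m - j) c j * (real (j choose n) / real (m choose n)))"
  proof (intro sum.cong refl)
    fix j assume j: "j \<in> {n..m}"
    then have "(m choose j) * (j choose n) = (m choose n) * ((m - n) choose (j - n))"
      by (intro choose_mult) auto
    then have "real (m choose j) * real (j choose n) = real (m choose n) * real ((m - n) choose (j - n))"
      by (metis of_nat_mult)
    moreover have "real (m choose n) \<noteq> 0" using assms by simp
    ultimately show "real ((m - n) choose (j - n)) * alt_diff (m - j) c j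
      = real (m choose j) * alt_diff (m - j) c j * (real (j choose n) / real (m choose n))"
      by (simp add: field_simps)
  qed
  \<comment> \<open>The terms with j < n vanish because \<open>j choose n\<close> is 0.\<close>
  also have "\<dots> = (\<Sum>j\<le>m. real (m choose j) * alt_diff (m - j) c j * (real (j choose n) / real (m choose n)))"
    by (rule sum.mono_neutral_left) (auto simp: not_le)
  finally show ?thesis .
qed

text \<open>Drawing n times without replacement against drawing with replacement, compared factor by
  factor. The hypothesis 2n < m keeps m - i above m/2: this bounds every factor by 1 in absolute
  value, even those that are negative because j < i, and it is the origin of the inner constant
  2.\<close>

lemma binomial_ratio_approx:
  assumes "2 * n < m" "j \<le> m"
  shows "\<bar>real (j choose n) / real (m choose n) - (real j / real m) ^ n\<bar> \<le> real n * (2 * real n / real m)"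
proof -
  have prod: "real (k choose n) = (\<Prod>i<n. real k - real i) / fact n" for k
    by (simp add: binomial_gbinomial gbinomial_prod_rev atLeast0LessThan)
  have nz: "real m - real i \<noteq> 0" if "i < n" for i using that assms by auto
  have "real (j choose n) / real (m choose n) = (\<Prod>i<n. (real j - real i) / (real m - real i))"
    by (simp add: prod prod_dividef)
  moreover have "(real j / real m) ^ n = (\<Prod>i<n. real j / real m)" by simp
  moreover have "norm ((\<Prod>i<n. (real j - real i) / (real m - real i)) - (\<Prod>i<n. real j / real m))
     \<le> (\<Sum>i<n. norm ((real j - real i) / (real m - real i) - real j / real m))"
    by (rule norm_prod_diff) (use assms in \<open>auto simp: abs_le_iff divide_simps\<close>)
  moreover have "(\<Sum>i<n. norm ((real j - real i) / (real m - real i) - real j / real m)) \<le> (\<Sum>i<n. 2 * real n / real m)"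
  proof (rule sum_mono)
    fix i assume "i \<in> {..<n}"
    then have i: "i < n" by simp
    have pos: "real m - real i > 0" "real m > 0" using i assms by auto
    have "(real j - real i) / (real m - real i) - real j / real m
        = - (real i * (real m - real j) / (real m * (real m - real i)))"
      using pos by (simp add: field_simps)
    then have "norm ((real j - real i) / (real m - real i) - real j / real m)
        = (real i / real m) * ((real m - real j) / (real m - real i))"
      using pos assms by (simp add: abs_mult)
    also have "\<dots> \<le> (real n / real m) * 2"
      using pos assms i by (intro mult_mono divide_right_mono) (auto simp: divide_simps)
    finally show "norm ((real j - real i) / (real m - real i) - real j / real m) \<le> 2 * real n / real m"
      by (simp add: field_simps)
  qed
  ultimately show ?thesis by simp
qed

text \<open>Bernstein weights on the points j/m define distributions whose n-th moment differs from
  \<open>c n\<close> by O(1/m); Helly selection gives a limit. The integrand is clamped to [0,1] so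
  that it is a bounded continuous test function on the whole line, and the support of the limit need
  not be discussed.\<close>

theorem hausdorff_moment_problem:
  assumes c0: "c 0 = 1" and pos: "\<And>k n. alt_diff k c n \<ge> 0"
  shows "\<exists>M. real_distribution M \<and> (\<forall>n. (\<integral>u. (max 0 (min 1 u)) ^ n \<partial>M) = c n)"
proof -
  define w where "w m j = (if j \<le> m then real (m choose j) * alt_diff (m - j) c j else 0)" for m j
  have w_nonneg: "w m j \<ge> 0" for m j using pos by (simp add: w_def)
  have w_sum: "(\<Sum>j\<le>m. w m j) = 1" for m
    using moment_eq_binomial_average[of 0 m c] c0 by (simp add: w_def)
  define p where "p m = embed_pmf (w m)" for m
  have w_nn: "(\<integral>\<^sup>+ j. ennreal (w m j) \<partial>count_space UNIV) = 1" for m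
  proof -
    have "(\<integral>\<^sup>+ j. ennreal (w m j) \<partial>count_space UNIV) = (\<Sum>j\<in>{..m}. ennreal (w m j))"
      by (rule nn_integral_count_space') (auto simp: w_def)
    also have "\<dots> = ennreal (\<Sum>j\<le>m. w m j)" by (rule sum_ennreal) (rule w_nonneg)
    finally show ?thesis by (simp add: w_sum)
  qed
  have pmf_p: "pmf (p m) j = w m j" for m j
    unfolding p_def by (rule pmf_embed_pmf) (auto simp: w_nonneg w_nn)
  have set_p: "set_pmf (p m) \<subseteq> {..m}" for m
    by (auto simp: set_pmf_eq pmf_p w_def)
  \<comment> \<open>For m = 0 the quotient is 0 by the convention for division, so
    \<open>\<mu> 0\<close> is a point mass at 0 and tightness holds for every index.\<close>
  define \<mu> where "\<mu> m = distr (measure_pmf (p m)) borel (\<lambda>j. real j / real m)" for m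
  have rd: "real_distribution (\<mu> m)" for m
    unfolding \<mu>_def by (rule prob_space.real_distribution_distr) (auto simp: measure_pmf.prob_space_axioms)
  have int_\<mu>: "(\<integral>u. g u \<partial>\<mu> m) = (\<Sum>j\<le>m. w m j * g (real j / real m))"
    if "g \<in> borel_measurable borel" for g :: "real \<Rightarrow> real" and m
  proof -
    have "(\<integral>u. g u \<partial>\<mu> m) = (\<integral>j. g (real j / real m) \<partial>measure_pmf (p m))"
      unfolding \<mu>_def using that by (subst integral_distr) auto
    also have "\<dots> = (\<Sum>j\<le>m. w m j * g (real j / real m))"
      by (subst integral_measure_pmf[of "{..m}"]) (use set_p pmf_p in auto)
    finally show ?thesis .
  qed
  have "tight \<mu>"
    unfolding tight_def
  proof (intro conjI allI impI rd)
    fix \<epsilon> :: real assume "\<epsilon> > 0"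
    \<comment> \<open>Tightness is stated with intervals open on the left, so the left end must lie
      below 0 to catch an atom there.\<close>
    have "measure (\<mu> m) {-1<..1} = 1" for m
    proof -
      have "measure (\<mu> m) {-1<..1} = measure (measure_pmf (p m)) ((\<lambda>j. real j / real m) -` {-1<..1})"
        unfolding \<mu>_def by (subst measure_distr) auto
      also have "\<dots> = 1"
      proof (rule measure_pmf.prob_eq_1[THEN iffD2])
        have "real j / real m \<in> {-1<..1}" if "j \<le> m" for j
        proof -
          have "real j / real m > -1" "real j / real m \<le> 1"
            using that by (auto simp: divide_le_eq_1 intro: less_le_trans[of _ 0])
          then show ?thesis by simp
        qed
        then show "AE x in measure_pmf (p m). x \<in> (\<lambda>j. real j / real m) -` {-1<..1}"
          using set_p[of m] by (auto simp: AE_measure_pmf_iff simp del: greaterThanAtMost_iff)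
      qed auto
      finally show ?thesis .
    qed
    then show "\<exists>a b. a < b \<and> (\<forall>n. measure (\<mu> n) {a<..b} > 1 - \<epsilon>)"
      using \<open>\<epsilon> > 0\<close> by (intro exI[of _ "-1"] exI[of _ 1]) auto
  qed
  from tight_imp_convergent_subsubsequence[OF this strict_mono_id] obtain r M where
    r: "strict_mono (r :: nat \<Rightarrow> nat)" and M: "real_distribution M" and conv: "weak_conv_m (\<mu> \<circ> r) M"
    by (auto simp: comp_def id_def)
  have "(\<integral>u. (max 0 (min 1 u)) ^ n \<partial>M) = c n" for n
  proof -
    let ?g = "\<lambda>u::real. (max 0 (min 1 u)) ^ n"
    have "(\<lambda>i. integral\<^sup>L ((\<mu> \<circ> r) i) ?g) \<longlonglongrightarrow> integral\<^sup>L M ?g"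
    proof (rule weak_conv_imp_integral_bdd_continuous_conv[OF _ M conv, where B=1])
      show "real_distribution ((\<mu> \<circ> r) i)" for i by (simp add: rd)
      show "isCont ?g x" for x by (intro continuous_intros)
      show "norm (?g x) \<le> 1" for x by (simp add: power_le_one)
    qed
    moreover have "(\<lambda>m. integral\<^sup>L (\<mu> m) ?g) \<longlonglongrightarrow> c n"
    proof -
      have "(\<lambda>m. integral\<^sup>L (\<mu> m) ?g - c n) \<longlonglongrightarrow> 0"
      proof (rule tendsto_rabs_zero_cancel, rule tendsto_sandwich[OF _ _ tendsto_const])
        show "(\<lambda>m. real n * (2 * real n / real m)) \<longlonglongrightarrow> 0"
          by real_asymp
        show "\<forall>\<^sub>F m in sequentially. \<bar>integral\<^sup>L (\<mu> m) ?g - c n\<bar> \<le> real n * (2 * real n / real m)"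
          using eventually_gt_at_top[of "2 * n"]
        proof eventually_elim
          case (elim m)
          have "integral\<^sup>L (\<mu> m) ?g = (\<Sum>j\<le>m. w m j * (real j / real m) ^ n)"
          proof (subst int_\<mu>)
            have "max 0 (min 1 (real j / real m)) = real j / real m" if "j \<le> m" for j
              using that elim by (simp add: min_def max_def divide_le_eq_1)
            then show "(\<Sum>j\<le>m. w m j * (max 0 (min 1 (real j / real m))) ^ n)
                = (\<Sum>j\<le>m. w m j * (real j / real m) ^ n)"
              by simp
          qed auto
          moreover have "c n = (\<Sum>j\<le>m. w m j * (real (j choose n) / real (m choose n)))"
            using moment_eq_binomial_average[of n m c] elim by (simp add: w_def)
          ultimately have "\<bar>integral\<^sup>L (\<mu> m) ?g - c n\<bar>
             = \<bar>\<Sum>j\<le>m. w m j * ((real j / real m) ^ n - real (j choose n) / real (m choose n))\<bar>"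
            by (simp add: sum_subtractf[symmetric] right_diff_distrib)
          also have "\<dots> \<le> (\<Sum>j\<le>m. w m j * (real n * (2 * real n / real m)))"
          proof (rule order_trans[OF sum_abs sum_mono])
            fix j assume "j \<in> {..m}"
            then have "\<bar>(real j / real m) ^ n - real (j choose n) / real (m choose n)\<bar> \<le> real n * (2 * real n / real m)"
              using binomial_ratio_approx[OF elim] by (subst abs_minus_commute) auto
            then show "\<bar>w m j * ((real j / real m) ^ n - real (j choose n) / real (m choose n))\<bar>
                \<le> w m j * (real n * (2 * real n / real m))"
              using w_nonneg[of m j] by (simp only: abs_mult abs_of_nonneg) (rule mult_left_mono)
          qed
          also have "\<dots> = real n * (2 * real n / real m)"
            by (simp only: sum_distrib_right[symmetric] w_sum mult_1)
          finally show ?case .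
        qed
      qed auto
      then show ?thesis by (rule LIM_zero_cancel)
    qed
    then have "(\<lambda>i. integral\<^sup>L ((\<mu> \<circ> r) i) ?g) \<longlonglongrightarrow> c n"
      using LIMSEQ_subseq_LIMSEQ[OF _ r, of "\<lambda>m. integral\<^sup>L (\<mu> m) ?g"] by (simp add: comp_def)
    ultimately show ?thesis by (rule LIMSEQ_unique)
  qed
  then show ?thesis using M by blast
qed

section \<open>Complete monotonicity of finite order\<close>

text \<open>Signs are absorbed by naming the negated derivative h, so that h satisfies the same kind
  of condition one order lower. Keeping h existential permits inductions on the order without
  formulas for higher derivatives of products or exponentials.\<close>

fun cm_upto :: "nat \<Rightarrow> (real \<Rightarrow> real) \<Rightarrow> bool" where
  "cm_upto 0 g \<longleftrightarrow> (\<forall>t>0. g t \<ge> 0)"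
| "cm_upto (Suc n) g \<longleftrightarrow> (\<forall>t>0. g t \<ge> 0) \<and>
     (\<exists>h. (\<forall>t>0. (g has_real_derivative - h t) (at t)) \<and> cm_upto n h)"

lemma cm_upto_nonneg: "cm_upto n g \<Longrightarrow> t > 0 \<Longrightarrow> g t \<ge> 0"
  by (cases n) auto

lemma cm_upto_SucD: "cm_upto (Suc n) g \<Longrightarrow> cm_upto n g"
proof (induction n arbitrary: g)
  case (Suc n)
  then show ?case by (metis cm_upto.simps(2))
qed auto

lemma cm_upto_add: "cm_upto n a \<Longrightarrow> cm_upto n b \<Longrightarrow> cm_upto n (\<lambda>t. a t + b t)"
proof (induction n arbitrary: a b)
  case (Suc n)
  then obtain a' b' where
    "\<forall>t>0. (a has_real_derivative - a' t) (at t)" "cm_upto n a'"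
    "\<forall>t>0. (b has_real_derivative - b' t) (at t)" "cm_upto n b'"
    by auto
  then show ?case
    using Suc by (auto intro!: exI[of _ "\<lambda>t. a' t + b' t"] derivative_eq_intros)
qed auto

text \<open>By the product rule the negated derivative of a b is a' b + a b', where a', b' are the
  negated derivatives; each summand falls under the induction hypothesis once the undifferentiated
  factor is lowered by one order.\<close>

lemma cm_upto_mult: "cm_upto n a \<Longrightarrow> cm_upto n b \<Longrightarrow> cm_upto n (\<lambda>t. a t * b t)"
proof (induction n arbitrary: a b)
  case (Suc n)
  then obtain a' b' where d:
    "\<forall>t>0. (a has_real_derivative - a' t) (at t)" "cm_upto n a'"
    "\<forall>t>0. (b has_real_derivative - b' t) (at t)" "cm_upto n b'"
    by auto
  have "cm_upto n (\<lambda>t. a' t * b t + a t * b' t)"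
    using d cm_upto_SucD[OF Suc.prems(1)] cm_upto_SucD[OF Suc.prems(2)] by (intro cm_upto_add Suc.IH)
  then show ?case
    using Suc.prems d
    by (auto intro!: exI[of _ "\<lambda>t. a' t * b t + a t * b' t"] derivative_eq_intros simp: algebra_simps)
qed auto

lemma cm_upto_cmult: "cm_upto n g \<Longrightarrow> x \<ge> 0 \<Longrightarrow> cm_upto n (\<lambda>t. x * g t)"
proof (induction n arbitrary: g)
  case (Suc n)
  then obtain h where "\<forall>t>0. (g has_real_derivative - h t) (at t)" "cm_upto n h" by auto
  then show ?case
    using Suc by (auto intro!: exI[of _ "\<lambda>t. x * h t"] derivative_eq_intros)
qed auto

text \<open>One order is spent: nonnegativity of the difference is monotonicity of g, which needs a
  signed first derivative. Higher orders follow since differencing commutes with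
  differentiation.\<close>

lemma cm_upto_diff_shift:
  "cm_upto (Suc n) g \<Longrightarrow> h > 0 \<Longrightarrow> cm_upto n (\<lambda>t. g t - g (t + h))"
proof (induction n arbitrary: g)
  case 0
  then obtain g' where g': "\<And>t. t > 0 \<Longrightarrow> (g has_real_derivative - g' t) (at t)" "\<And>t. t > 0 \<Longrightarrow> g' t \<ge> 0"
    by auto
  have "g (t + h) \<le> g t" if "t > 0" for t
  proof (rule DERIV_nonpos_imp_nonincreasing[where f=g and a=t and b="t + h"])
    show "t \<le> t + h" using 0 by simp
    fix x assume "t \<le> x" "x \<le> t + h"
    then show "\<exists>y. (g has_real_derivative y) (at x) \<and> y \<le> 0"
      using g'[of x] that by (intro exI[of _ "- g' x"]) auto
  qed
  then show ?case by simp
next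
  case (Suc n)
  then obtain g' where g': "\<And>t. t > 0 \<Longrightarrow> (g has_real_derivative - g' t) (at t)" "cm_upto (Suc n) g'"
    by (metis cm_upto.simps(2))
  have IH: "cm_upto n (\<lambda>t. g' t - g' (t + h))"
    using Suc g' by blast
  have "cm_upto n (\<lambda>t. g t - g (t + h))"
    using Suc.prems by (intro Suc.IH) (auto dest: cm_upto_SucD simp del: cm_upto.simps)
  then have nn: "g t - g (t + h) \<ge> 0" if "t > 0" for t
    using that by (rule cm_upto_nonneg[where g="\<lambda>t. g t - g (t + h)"])
  have "((\<lambda>t. g t - g (t + h)) has_real_derivative - (g' t - g' (t + h))) (at t)" if "t > 0" for t
  proof -
    have "((\<lambda>t. g (t + h)) has_real_derivative - g' (t + h)) (at t)"
      using g'(1)[of "t + h"] that Suc.prems by (simp add: DERIV_shift)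
    from DERIV_diff[OF g'(1)[OF that] this] show ?thesis by simp
  qed
  then show ?case
    using IH nn unfolding cm_upto.simps
    by (intro conjI exI[of _ "\<lambda>t. g' t - g' (t + h)"]) auto
qed

text \<open>Differencing the samples of g is sampling \<open>g t - g (t + h)\<close>, so each of the
  k differences costs one order of monotonicity.\<close>

lemma cm_upto_alt_diff_nonneg:
  assumes "cm_upto k g" "h > 0" "t > 0"
  shows "alt_diff k (\<lambda>n. g (t + real n * h)) n \<ge> 0"
  using assms
proof (induction k arbitrary: g)
  case 0
  then show ?case by (simp add: add_pos_nonneg)
next
  case (Suc k)
  have "alt_diff (Suc k) (\<lambda>n. g (t + real n * h)) n
     = alt_diff k (\<lambda>n. g (t + real n * h) - g ((t + real n * h) + h)) n"
    unfolding alt_diff_shift by (simp add: algebra_simps)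
  then show ?case
    using Suc.IH[OF cm_upto_diff_shift[OF Suc.prems(1,2)]] Suc.prems by simp
qed

lemma bernstein_derivative_cm_upto:
  assumes "bernstein_function f"
  shows "cm_upto n (\<lambda>t. (-1) ^ m * (deriv ^^ Suc m) f t)"
proof -
  have nn: "(-1) ^ m * (deriv ^^ Suc m) f t \<ge> 0" if "t > 0" for m t
    using assms that unfolding bernstein_function_def
    by (auto dest!: spec[of _ "Suc m"])
  show ?thesis
  proof (induction n arbitrary: m)
    case 0
    then show ?case using nn by simp
  next
    case (Suc n)
    have "((\<lambda>t. (-1) ^ m * (deriv ^^ Suc m) f t) has_real_derivative
         - ((-1) ^ Suc m * (deriv ^^ Suc (Suc m)) f t)) (at t)" if "t > 0" for t
    proof -
      have "((deriv ^^ Suc m) f has_real_derivative (deriv ^^ Suc (Suc m)) f t) (at t)"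
        using assms that unfolding bernstein_function_def by blast
      from DERIV_cmult[OF this, of "(-1)^m"] show ?thesis by simp
    qed
    then show ?case
      using Suc[of "Suc m"] nn unfolding cm_upto.simps
      by (intro conjI exI[of _ "\<lambda>t. (-1) ^ Suc m * (deriv ^^ Suc (Suc m)) f t"]) auto
  qed
qed

lemma bernstein_has_derivative:
  assumes "bernstein_function f" "t > 0"
  shows "(f has_real_derivative deriv f t) (at t)"
proof -
  have "((deriv ^^ 0) f has_real_derivative (deriv ^^ Suc 0) f t) (at t)"
    using assms unfolding bernstein_function_def by blast
  then show ?thesis by simp
qed

text \<open>The negated derivative is x f' exp(-x f). Here f' is completely monotone and the
  exponential has the lower order by induction, so closure under products closes the step.\<close>

lemma cm_upto_exp_bernstein:
  assumes "bernstein_function f" "x \<ge> 0"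
  shows "cm_upto n (\<lambda>t. exp (- x * f t))"
proof (induction n)
  case (Suc n)
  have "cm_upto n (deriv f)"
    using bernstein_derivative_cm_upto[OF assms(1), of n 0] by simp
  then have "cm_upto n (\<lambda>t. x * deriv f t * exp (- x * f t))"
    using Suc assms by (intro cm_upto_mult cm_upto_cmult)
  moreover have "((\<lambda>t. exp (- x * f t)) has_real_derivative - (x * deriv f t * exp (- x * f t))) (at t)"
    if "t > 0" for t
    using bernstein_has_derivative[OF assms(1) that] by (auto intro!: derivative_eq_intros)
  ultimately show ?case
    unfolding cm_upto.simps by (intro conjI exI[of _ "\<lambda>t. x * deriv f t * exp (- x * f t)"]) auto
qed simp

lemma bernstein_mono:
  assumes "bernstein_function f" "0 < a" "a \<le> b"
  shows "f a \<le> f b"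
proof (rule DERIV_nonneg_imp_nondecreasing[OF assms(3)])
  fix x assume "a \<le> x" "x \<le> b"
  then have "x > 0" using assms by simp
  moreover have "deriv f x \<ge> 0"
    using bernstein_derivative_cm_upto[OF assms(1), of 0 0] \<open>x > 0\<close> by simp
  ultimately show "\<exists>y. (f has_real_derivative y) (at x) \<and> 0 \<le> y"
    using bernstein_has_derivative[OF assms(1)] by blast
qed

lemma bernstein_nonneg: "bernstein_function f \<Longrightarrow> x > 0 \<Longrightarrow> f x \<ge> 0"
  by (simp add: bernstein_function_def)

text \<open>The value of f at 0 carries no information, so the samples are taken at \<epsilon> + n
  h. Since f is nonnegative, replacing the 0-th sample by 1 only raises it and keeps all differences
  nonnegative; then \<epsilon> tends to 0.\<close>

lemma exp_bernstein_alt_diff_nonneg: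
  assumes f: "bernstein_function f" and x: "x \<ge> 0" and h: "h > 0"
  shows "alt_diff k (\<lambda>n. if n = 0 then 1 else exp (- x * f (real n * h))) n \<ge> 0"
    (is "alt_diff k ?c n \<ge> 0")
proof (rule tendsto_lowerbound)
  let ?g = "\<lambda>\<epsilon> n. exp (- x * f (\<epsilon> + real n * h))"
  let ?d = "\<lambda>\<epsilon>. (?g \<epsilon>)(0 := 1)"
  have cont: "isCont (\<lambda>t. exp (- x * f t)) t" if "t > 0" for t
    using bernstein_has_derivative[OF f that] by (intro continuous_intros DERIV_isCont)
  have "((\<lambda>\<epsilon>. ?d \<epsilon> m) \<longlongrightarrow> ?c m) (at_right 0)" for m
  proof (cases "m = 0")
    case False
    have lim: "((\<lambda>\<epsilon>. \<epsilon> + real m * h) \<longlongrightarrow> real m * h) (at_right 0)"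
      by (auto intro!: tendsto_eq_intros)
    have "((\<lambda>\<epsilon>. ?g \<epsilon> m) \<longlongrightarrow> exp (- x * f (real m * h))) (at_right 0)"
      by (rule isCont_tendsto_compose[OF cont lim]) (use False h in auto)
    then show ?thesis using False by simp
  qed simp
  then show "((\<lambda>\<epsilon>. alt_diff k (?d \<epsilon>) n) \<longlongrightarrow> alt_diff k ?c n) (at_right 0)"
    by (rule tendsto_alt_diff)
  show "\<forall>\<^sub>F \<epsilon> in at_right 0. 0 \<le> alt_diff k (?d \<epsilon>) n"
    using eventually_at_right_less[of 0]
  proof eventually_elim
    case (elim \<epsilon>)
    have nn: "alt_diff k (?g \<epsilon>) n \<ge> 0"
      by (rule cm_upto_alt_diff_nonneg[where g="\<lambda>t. exp (- x * f t)", OF cm_upto_exp_bernstein[OF f x] h elim])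
    have "exp (- x * f (\<epsilon> + real 0 * h)) \<le> 1"
      using bernstein_nonneg[OF f elim] x by simp
    then show ?case
      using nn by (cases n) (auto simp only: alt_diff_upd_0 alt_diff_upd_0_Suc)
  qed
qed simp

section \<open>Measures on the extended half-line\<close>

text \<open>The value at \<infinity> is set by hand because \<open>enn2real \<top>\<close> is 0,
  which would give 1 there.\<close>

definition eexp :: "ennreal \<Rightarrow> real" where
  "eexp y = (if y = \<top> then 0 else exp (- enn2real y))"

text \<open>A left inverse of \<open>eexp\<close>, made total by clamping: arguments below 0 go to
  \<infinity>, and those above 1 go to 0 since \<open>ennreal\<close> truncates negative
  numbers.\<close>

definition eln :: "real \<Rightarrow> ennreal" where
  "eln u = (if u \<le> 0 then \<top> else ennreal (- ln u))"

lemma eexp_top [simp]: "eexp \<top> = 0" and eexp_0 [simp]: "eexp 0 = 1"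
  by (auto simp: eexp_def)

lemma eexp_ennreal: "x \<ge> 0 \<Longrightarrow> eexp (ennreal x) = exp (- x)"
  by (simp add: eexp_def)

lemma eexp_nonneg [simp]: "eexp y \<ge> 0" and eexp_le_1 [simp]: "eexp y \<le> 1"
  by (auto simp: eexp_def)

lemma eexp_eln: "eexp (eln u) = max 0 (min 1 u)"
proof (cases "u \<le> 0 \<or> 1 \<le> u")
  case True
  then show ?thesis by (auto simp: eln_def eexp_def ennreal_neg)
next
  case False
  then show ?thesis by (simp add: eln_def eexp_ennreal)
qed

lemma eln_eexp: "eln (eexp y) = y"
  by (cases y) (auto simp: eexp_def eln_def not_le)

lemma eexp_add: "eexp (a + b) = eexp a * eexp b"
  by (cases a; cases b) (auto simp: eexp_ennreal exp_add[symmetric] simp flip: ennreal_plus)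

lemma eexp_of_nat_mult: "N > 0 \<Longrightarrow> eexp (of_nat N * y) = eexp y ^ N"
proof (induction N rule: nat_induct_non_zero)
  case (Suc n)
  then show ?case by (simp add: distrib_right eexp_add)
qed simp

lemma continuous_eexp: "continuous_on UNIV eexp"
proof (rule continuous_at_imp_continuous_on, rule ballI)
  fix y :: ennreal
  show "isCont eexp y"
  proof (cases y)
    case (real r)
    have "((\<lambda>y. exp (- enn2real y)) \<longlongrightarrow> exp (- r)) (at y)"
      using real by (intro tendsto_intros tendsto_enn2real) (auto intro: tendsto_ident_at)
    moreover have "\<forall>\<^sub>F z in at y. exp (- enn2real z) = eexp z"
    proof -
      have "\<forall>\<^sub>F z in at y. z < \<top>"
        by (rule order_tendstoD(2)[OF tendsto_ident_at]) (use real in auto)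
      then show ?thesis by eventually_elim (auto simp: eexp_def)
    qed
    ultimately show ?thesis
      using real by (simp add: isCont_def eexp_ennreal) (rule Lim_transform_eventually)
  next
    case top
    have "(eexp \<longlongrightarrow> 0) (at \<top>)"
    proof (rule order_tendstoI)
      fix a :: real assume "a < 0"
      then show "\<forall>\<^sub>F x in at \<top>. a < eexp x"
        by (intro always_eventually) (auto intro: less_le_trans)
    next
      fix a :: real assume a: "0 < a"
      have "\<forall>\<^sub>F x in at \<top>. ennreal (max 0 (- ln a)) < x"
        by (rule order_tendstoD(1)[OF tendsto_ident_at]) simp
      then show "\<forall>\<^sub>F x in at \<top>. eexp x < a"
      proof eventually_elim
        case (elim x)
        then show ?case
        proof (cases x)
          case (real r)
          then have "max 0 (- ln a) < r" using elim by (simp only: ennreal_less_iff max.cobounded1)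
          then have "- r < ln a" by simp
          then have "exp (- r) < a" using a by (metis exp_less_cancel_iff exp_ln)
          then show ?thesis using real by (simp add: eexp_ennreal)
        qed (use a in simp)
      qed
    qed
    then show ?thesis using top by (simp add: isCont_def)
  qed
qed

lemma measurable_eexp [measurable]: "eexp \<in> borel_measurable borel"
  by (rule borel_measurable_continuous_onI[OF continuous_eexp])

lemma measurable_eln [measurable]: "eln \<in> borel_measurable borel"
  unfolding eln_def by measurable

text \<open>Inverse of a continuous injection on a compact space.\<close>

lemma continuous_eln: "continuous_on {0..1} eln"
proof -
  have "eexp ` UNIV = {0..1}"
  proof (intro subset_antisym subsetI)
    fix u :: real assume "u \<in> {0..1}"
    then have "eexp (eln u) = u" by (simp add: eexp_eln)
    then show "u \<in> range eexp" by (metis rangeI)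
  qed auto
  then show ?thesis
    using continuous_on_inv[OF continuous_eexp compact_UNIV, of eln] by (simp add: eln_eexp)
qed

section \<open>Determinacy of measures on [0,\<infinity>] by integer moments\<close>

lemma eexp_polynomial_approx:
  fixes f :: "ennreal \<Rightarrow> real"
  assumes "continuous_on UNIV f" "\<epsilon> > 0"
  shows "\<exists>a N. \<forall>y. \<bar>f y - (\<Sum>i\<le>N. a i * eexp y ^ i)\<bar> < \<epsilon>"
proof -
  have "continuous_on {0..1} (f \<circ> eln)"
    by (intro continuous_on_compose continuous_eln continuous_on_subset[OF assms(1)]) auto
  then obtain g where g: "real_polynomial_function g" "\<And>u. u \<in> {0..1} \<Longrightarrow> \<bar>(f \<circ> eln) u - g u\<bar> < \<epsilon>"
    using Stone_Weierstrass_real_polynomial_function[of "{0..1}" "f \<circ> eln" \<epsilon>] assms by auto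
  then obtain a N where "g = (\<lambda>x. \<Sum>i\<le>N. a i * x ^ i)"
    by (auto simp: real_polynomial_function_iff_sum)
  then have "\<bar>f y - (\<Sum>i\<le>N. a i * eexp y ^ i)\<bar> < \<epsilon>" for y
    using g(2)[of "eexp y"] by (simp add: eln_eexp)
  then show ?thesis by blast
qed

lemma integrable_continuous_ennreal:
  fixes f :: "ennreal \<Rightarrow> real"
  assumes "prob_space M" "sets M = sets borel" "continuous_on UNIV f"
  shows "integrable M f"
proof -
  interpret prob_space M by fact
  have "bounded (range f)"
    using assms(3) compact_UNIV compact_continuous_image compact_imp_bounded by blast
  then obtain B where "\<And>y. norm (f y) \<le> B" by (auto simp: bounded_iff)
  moreover have "f \<in> borel_measurable M"
    using borel_measurable_continuous_onI[OF assms(3)] measurable_cong_sets[OF assms(2) refl] by blast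
  ultimately show ?thesis by (intro integrable_const_bound[where B=B]) auto
qed

lemma integrable_eexp_power:
  "prob_space M \<Longrightarrow> sets M = sets borel \<Longrightarrow> integrable M (\<lambda>y. eexp y ^ n)"
  by (intro integrable_continuous_ennreal continuous_on_power continuous_eexp)

text \<open>The polynomial is fixed before the measure, so one approximation serves all measures
  with the same error. This uniformity gives uniqueness here and weak continuity of kernels
  later.\<close>

lemma integral_polynomial_approx:
  fixes f :: "ennreal \<Rightarrow> real"
  assumes M: "prob_space M" "sets M = sets borel" and f: "continuous_on UNIV f"
    and approx: "\<And>y. \<bar>f y - (\<Sum>i\<le>N. a i * eexp y ^ i)\<bar> < \<epsilon>"
  shows "\<bar>(\<integral>y. f y \<partial>M) - (\<Sum>i\<le>N. a i * (\<integral>y. eexp y ^ i \<partial>M))\<bar> \<le> \<epsilon>"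
proof -
  interpret prob_space M by fact
  note int = integrable_eexp_power[OF M] integrable_continuous_ennreal[OF M f]
  have "(\<integral>y. f y \<partial>M) - (\<Sum>i\<le>N. a i * (\<integral>y. eexp y ^ i \<partial>M)) = (\<integral>y. f y - (\<Sum>i\<le>N. a i * eexp y ^ i) \<partial>M)"
    using int by simp
  also have "\<bar>\<dots>\<bar> \<le> (\<integral>y. \<bar>f y - (\<Sum>i\<le>N. a i * eexp y ^ i)\<bar> \<partial>M)"
    using integral_norm_bound[of M "\<lambda>y. f y - (\<Sum>i\<le>N. a i * eexp y ^ i)"] by simp
  also have "\<dots> \<le> (\<integral>y. \<epsilon> \<partial>M)"
    using int approx by (intro integral_mono) (auto intro: less_imp_le)
  finally show ?thesis by (simp add: prob_space)
qed

lemma integral_continuous_eq_of_moments_eq: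
  fixes f :: "ennreal \<Rightarrow> real"
  assumes M: "prob_space M" "sets M = sets borel" and N: "prob_space N" "sets N = sets borel"
    and eq: "\<And>n. (\<integral>y. eexp y ^ n \<partial>M) = (\<integral>y. eexp y ^ n \<partial>N)" and f: "continuous_on UNIV f"
  shows "(\<integral>y. f y \<partial>M) = (\<integral>y. f y \<partial>N)"
proof (rule ccontr)
  assume "\<not> ?thesis"
  \<comment> \<open>A third of the gap: two approximation errors together cannot bridge it.\<close>
  then have "\<bar>(\<integral>y. f y \<partial>M) - (\<integral>y. f y \<partial>N)\<bar> / 3 > 0" (is "?e > 0") by simp
  then obtain a K where "\<And>y. \<bar>f y - (\<Sum>i\<le>K. a i * eexp y ^ i)\<bar> < ?e"
    using eexp_polynomial_approx[OF f] by meson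
  from integral_polynomial_approx[OF M f this] integral_polynomial_approx[OF N f this] \<open>?e > 0\<close> eq
  show False by (simp add: abs_if split: if_splits)
qed

text \<open>Equal moments give equal integrals of continuous functions, in particular of cos(t
  \<open>eexp\<close>) and sin(t \<open>eexp\<close>). So the images under \<open>eexp\<close> have
  the same characteristic function and coincide, and \<open>eln\<close> carries the equality
  back.\<close>

theorem measure_eqI_moments:
  assumes M: "prob_space M" "sets M = sets borel" and N: "prob_space N" "sets N = sets borel"
    and eq: "\<And>n. n > 0 \<Longrightarrow> (\<integral>y. eexp y ^ n \<partial>M) = (\<integral>y. eexp y ^ n \<partial>N)"
  shows "M = N"
proof -
  have eq': "(\<integral>y. eexp y ^ n \<partial>M) = (\<integral>y. eexp y ^ n \<partial>N)" for n
    using eq[of n] M(1) N(1) by (cases n) (auto simp: prob_space.prob_space)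
  have [measurable_cong]: "sets M = sets borel" "sets N = sets borel" by fact+
  have rd: "real_distribution (distr L borel eexp)" if "prob_space L" "sets L = sets borel" for L
    using that by (intro prob_space.real_distribution_distr) (auto simp: measurable_cong_sets[OF that(2) refl])
  have char: "char (distr L borel eexp) t
      = Complex (\<integral>y. cos (t * eexp y) \<partial>L) (\<integral>y. sin (t * eexp y) \<partial>L)"
    if L: "prob_space L" "sets L = sets borel" for L t
  proof -
    interpret prob_space L by fact
    have [measurable_cong]: "sets L = sets borel" by fact
    have int: "complex_integrable L (\<lambda>y. iexp (t * eexp y))"
      by (rule integrable_const_bound[where B=1]) auto
    have "char (distr L borel eexp) t = (\<integral>y. iexp (t * eexp y) \<partial>L)"
      unfolding char_def by (subst integral_distr) auto
    then show ?thesis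
      using integral_Re[OF int] integral_Im[OF int] by (intro complex_eqI) (simp_all add: Re_exp Im_exp)
  qed
  have "char (distr M borel eexp) t = char (distr N borel eexp) t" for t
  proof -
    have "continuous_on UNIV (\<lambda>y. cos (t * eexp y))" "continuous_on UNIV (\<lambda>y. sin (t * eexp y))"
      by (intro continuous_intros continuous_eexp)+
    then show ?thesis
      unfolding char[OF M] char[OF N]
      using integral_continuous_eq_of_moments_eq[OF M N eq'] by simp
  qed
  then have "distr M borel eexp = distr N borel eexp"
    by (intro Levy_uniqueness rd M N ext)
  then have "distr (distr M borel eexp) borel eln = distr (distr N borel eexp) borel eln" by simp
  then have "distr M borel id = distr N borel id"
    by (simp add: distr_distr comp_def eln_eexp id_def)
  then show ?thesis
    using distr_id2[OF M(2)[symmetric]] distr_id2[OF N(2)[symmetric]] by (simp add: id_def)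
qed

section \<open>Measures with a prescribed Laplace exponent\<close>

lemma exists_measure_with_moments_on_grid:
  assumes f: "bernstein_function f" and x: "x \<ge> 0" and h: "h > 0"
  shows "\<exists>M. prob_space M \<and> sets M = sets (borel :: ennreal measure) \<and>
     (\<forall>n>0. (\<integral>y. eexp y ^ n \<partial>M) = exp (- x * f (real n * h)))"
proof -
  let ?c = "\<lambda>n. if n = 0 then 1 else exp (- x * f (real n * h))"
  obtain M where M: "real_distribution M" "\<And>n. (\<integral>u. (max 0 (min 1 u)) ^ n \<partial>M) = ?c n"
    using hausdorff_moment_problem[of ?c] exp_bernstein_alt_diff_nonneg[OF assms] by auto
  interpret real_distribution M by fact
  have "(\<integral>y. eexp y ^ n \<partial>distr M borel eln) = exp (- x * f (real n * h))" if "n > 0" for n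
    using M(2)[of n] that by (subst integral_distr) (auto simp: eexp_eln)
  moreover have "prob_space (distr M borel eln)" by (rule prob_space_distr) simp
  ultimately show ?thesis by (intro exI[of _ "distr M borel eln"]) auto
qed

theorem exists_measure_with_laplace_exponent:
  assumes f: "bernstein_function f" and x: "x \<ge> 0"
  shows "\<exists>M. prob_space M \<and> sets M = sets (borel :: ennreal measure) \<and>
     (\<forall>\<theta>>0. (\<integral>y. eexp y powr \<theta> \<partial>M) = exp (- x * f \<theta>))"
proof -
  obtain M where M: "prob_space M" "sets M = sets (borel :: ennreal measure)"
    and mom: "\<And>n. n > 0 \<Longrightarrow> (\<integral>y. eexp y ^ n \<partial>M) = exp (- x * f (real n))"
    using exists_measure_with_moments_on_grid[OF assms, of 1] by auto
  interpret prob_space M by fact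
  have [measurable_cong]: "sets M = sets borel" by fact
  \<comment> \<open>A solution on the finer grid of mesh 1/N, rescaled by N, has the same integer moments as M,
    so it is M by uniqueness.\<close>
  have rat: "(\<integral>y. eexp y powr (real n / real N) \<partial>M) = exp (- x * f (real n / real N))"
    if n: "n > 0" and N: "N > 0" for n N :: nat
  proof -
    obtain L where L: "prob_space L" "sets L = sets (borel :: ennreal measure)"
      and momL: "\<And>n. n > 0 \<Longrightarrow> (\<integral>y. eexp y ^ n \<partial>L) = exp (- x * f (real n * (1 / real N)))"
      using exists_measure_with_moments_on_grid[OF assms, of "1 / real N"] N by auto
    have [measurable_cong]: "sets L = sets borel" by fact
    let ?L = "distr L borel (\<lambda>y. of_nat N * y)"
    have "(\<integral>y. eexp y ^ k \<partial>?L) = (\<integral>y. eexp y ^ k \<partial>M)" if "k > 0" for k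
    proof -
      have "(\<integral>y. eexp y ^ k \<partial>?L) = (\<integral>y. eexp y ^ (N * k) \<partial>L)"
        using N by (subst integral_distr) (auto simp: eexp_of_nat_mult power_mult)
      then show ?thesis using that N momL[of "N * k"] mom[of k] by simp
    qed
    then have "M = ?L"
      by (intro measure_eqI_moments M prob_space.prob_space_distr L) auto
    then have "(\<integral>y. eexp y powr (real n / real N) \<partial>M) = (\<integral>y. eexp y powr (real n / real N) \<partial>?L)"
      by simp
    also have "\<dots> = (\<integral>y. eexp y ^ n \<partial>L)"
    proof (subst integral_distr)
      have "(eexp y ^ N) powr (real n / real N) = eexp y ^ n" for y
      proof (cases "eexp y = 0")
        case False
        then have "eexp y > 0" by (simp add: less_le)
        then show ?thesis using N by (simp add: powr_powr flip: powr_realpow)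
      qed (use n N in \<open>simp add: zero_power\<close>)
      then show "(\<integral>y. eexp (of_nat N * y) powr (real n / real N) \<partial>L) = (\<integral>y. eexp y ^ n \<partial>L)"
        using N by (simp add: eexp_of_nat_mult)
    qed auto
    finally show ?thesis using momL[OF n] by simp
  qed
  have "(\<integral>y. eexp y powr \<theta> \<partial>M) = exp (- x * f \<theta>)" if \<theta>: "\<theta> > 0" for \<theta>
  proof -
    \<comment> \<open>The added 1 makes the rational \<open>q k\<close> positive, as
      \<open>rat\<close> requires, and places it between \<theta> and \<theta> + 1/(k+1).\<close>
    define n where "n k = nat \<lfloor>real (Suc k) * \<theta>\<rfloor> + 1" for k
    define q where "q k = real (n k) / real (Suc k)" for k
    have q: "q k > 0" for k by (simp add: q_def n_def)
    have q_ge: "q k \<ge> \<theta>" for k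
    proof -
      have "real (Suc k) * \<theta> \<le> real (n k)" unfolding n_def using \<theta> by linarith
      then show ?thesis by (simp add: q_def field_simps)
    qed
    have q_le: "q k \<le> \<theta> + 1 / real (Suc k)" for k
    proof -
      have "real (n k) \<le> real (Suc k) * \<theta> + 1"
        unfolding n_def using \<theta> by (simp add: of_nat_nat mult_nonneg_nonneg)
      then have "q k \<le> (real (Suc k) * \<theta> + 1) / real (Suc k)"
        unfolding q_def by (rule divide_right_mono) simp
      then show ?thesis by (simp add: add_divide_distrib)
    qed
    have "q \<longlonglongrightarrow> \<theta>"
    proof (rule tendsto_sandwich[OF _ _ tendsto_const])
      show "(\<lambda>k. \<theta> + 1 / real (Suc k)) \<longlonglongrightarrow> \<theta>" by real_asymp
    qed (use q_ge q_le in auto)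
    have "(\<lambda>k. \<integral>y. eexp y powr q k \<partial>M) \<longlonglongrightarrow> (\<integral>y. eexp y powr \<theta> \<partial>M)"
    proof (rule integral_dominated_convergence[where w="\<lambda>_. 1"])
      show "AE y in M. (\<lambda>k. eexp y powr q k) \<longlonglongrightarrow> eexp y powr \<theta>"
      proof (rule AE_I2)
        fix y
        show "(\<lambda>k. eexp y powr q k) \<longlonglongrightarrow> eexp y powr \<theta>"
          using \<open>q \<longlonglongrightarrow> \<theta>\<close> by (cases "eexp y = 0") (auto intro!: tendsto_intros)
      qed
      show "AE y in M. norm (eexp y powr q k) \<le> 1" for k
        using q[of k] by (simp add: powr_le1)
    qed auto
    moreover have "(\<lambda>k. \<integral>y. eexp y powr q k \<partial>M) = (\<lambda>k. exp (- x * f (q k)))"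
      unfolding q_def by (intro ext rat) (simp_all add: n_def)
    moreover have "(\<lambda>k. exp (- x * f (q k))) \<longlonglongrightarrow> exp (- x * f \<theta>)"
    proof -
      have "isCont f \<theta>" using bernstein_has_derivative[OF f \<theta>] by (rule DERIV_isCont)
      then show ?thesis
        using \<open>q \<longlonglongrightarrow> \<theta>\<close> by (intro tendsto_intros isCont_tendsto_compose[of _ f])
    qed
    ultimately show ?thesis using LIMSEQ_unique by metis
  qed
  then show ?thesis using M by blast
qed

section \<open>Laplace transforms on the right half-plane\<close>

definition borel_prob :: "ennreal measure \<Rightarrow> bool" where
  "borel_prob M \<longleftrightarrow> prob_space M \<and> sets M = sets borel"

lemma RHP_of_real [simp]: "complex_of_real x \<in> RHP \<longleftrightarrow> x > 0"
  by (simp add: RHP_def)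

lemma open_RHP: "open RHP" and convex_RHP: "convex RHP"
  unfolding RHP_def by (auto intro: open_halfspace_Re_gt convex_halfspace_Re_gt)

text \<open>The midpoint r/2 is a limit point of the interval. A bounded interval is allowed because
  \<open>\<phi>_zero\<close> knows the exponent only below one of its zeros.\<close>

lemma RHP_identity:
  assumes "f holomorphic_on RHP" "g holomorphic_on RHP"
    and "\<And>x. 0 < x \<Longrightarrow> x < r \<Longrightarrow> f (complex_of_real x) = g (complex_of_real x)" "r > 0" "z \<in> RHP"
  shows "f z = g z"
proof -
  let ?U = "complex_of_real ` {0<..<r}"
  have "complex_of_real (r / 2) islimpt ?U"
    unfolding islimpt_approachable
  proof (intro allI impI)
    fix e :: real assume "e > 0"
    let ?x = "r / 2 + min e (r / 2) / 2"
    have "?x \<in> {0<..<r}" "?x \<noteq> r / 2" "dist ?x (r / 2) < e"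
      using \<open>e > 0\<close> \<open>r > 0\<close> by (auto simp: dist_real_def min_def)
    then show "\<exists>x'\<in>?U. x' \<noteq> complex_of_real (r / 2) \<and> dist x' (complex_of_real (r / 2)) < e"
      by (intro bexI[of _ "complex_of_real ?x"] conjI) (auto simp only: of_real_eq_iff dist_of_real)
  qed
  then have "f z - g z = 0"
    by (rule analytic_continuation[where f="\<lambda>z. f z - g z", rotated 5])
       (use assms open_RHP convex_RHP RHP_of_real[of "r / 2"] in \<open>auto intro!: holomorphic_intros convex_connected\<close>)
  then show ?thesis by simp
qed

text \<open>The derivative in the exponent has modulus at most -ln u u^c on Re z \<ge> c, and exp(a)
  \<ge> 1 + a with a = -c ln u bounds this by 1/c. The bound does not depend on u, so it survives
  integration against any probability measure.\<close>

lemma powr_exponent_lipschitz: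
  assumes u: "0 \<le> u" "u \<le> 1" and c: "c > 0" "Re z \<ge> c" "Re w \<ge> c"
  shows "norm (complex_of_real u powr z - complex_of_real u powr w) \<le> 1 / c * norm (z - w)"
proof (cases "u = 0")
  case True
  then show ?thesis using c by simp
next
  case False
  then have u0: "u > 0" using u by simp
  show ?thesis
  proof (rule field_differentiable_bound[where S="{z. Re z \<ge> c}"
        and f'="\<lambda>z. Ln (complex_of_real u) * complex_of_real u powr z"])
    show "((\<lambda>z. complex_of_real u powr z) has_field_derivative Ln (complex_of_real u) * complex_of_real u powr z)
      (at z within {z. c \<le> Re z})" for z
      using u0 by (intro has_field_derivative_at_within[OF has_field_derivative_powr_right]) auto
    fix z assume "z \<in> {z. c \<le> Re z}"
    then have "u powr Re z \<le> u powr c" using u0 u by (intro powr_mono') auto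
    moreover have "norm (Ln (complex_of_real u) * complex_of_real u powr z) = - ln u * u powr Re z"
      using u0 u by (simp add: norm_mult Ln_of_real norm_powr_real_powr abs_of_nonpos)
    ultimately have "norm (Ln (complex_of_real u) * complex_of_real u powr z) \<le> - ln u * u powr c"
      using u0 u by (simp only:) (intro mult_left_mono, auto)
    also have "- ln u * u powr c \<le> 1 / c"
    proof -
      have "u powr c * (1 + c * - ln u) \<le> u powr c * exp (c * - ln u)"
        using exp_ge_add_one_self[of "c * - ln u"] by (intro mult_left_mono) auto
      also have "\<dots> = 1" using u0 by (simp add: powr_def exp_minus)
      finally have "c * (- ln u * u powr c) \<le> 1 - u powr c" by (simp add: algebra_simps)
      also have "\<dots> \<le> 1" by simp
      finally show ?thesis using c by (simp add: field_simps)
    qed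
    finally show "norm (Ln (complex_of_real u) * complex_of_real u powr z) \<le> 1 / c" .
  qed (use c in \<open>auto simp: convex_halfspace_Re_ge\<close>)
qed

lemma continuous_eexp_cpowr:
  assumes "Re z > 0"
  shows "continuous_on UNIV (\<lambda>y. complex_of_real (eexp y) powr z)"
proof (rule continuous_at_imp_continuous_on, rule ballI)
  fix y
  have "isCont eexp y"
    using continuous_eexp continuous_on_eq_continuous_at open_UNIV by blast
  then show "isCont (\<lambda>y. complex_of_real (eexp y) powr z) y"
    using assms by (intro continuous_powr_complex continuous_of_real continuous_const) auto
qed

text \<open>The Laplace transform at complex arguments in the coordinate u = exp(-y). Because 0
  \<open>powr\<close> z is 0, the state \<infinity> contributes nothing, in agreement with the
  indicator in \<open>laplace_relation\<close>.\<close>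

definition claplace :: "ennreal measure \<Rightarrow> complex \<Rightarrow> complex" where
  "claplace M z = (\<integral>y. complex_of_real (eexp y) powr z \<partial>M)"

lemma norm_eexp_cpowr_le_1: "Re z > 0 \<Longrightarrow> norm (complex_of_real (eexp y) powr z) \<le> 1"
  by (simp add: norm_powr_real_powr powr_le1)

lemma measurable_eexp_cpowr:
  assumes "sets M = sets borel" "Re z > 0"
  shows "(\<lambda>y. complex_of_real (eexp y) powr z) \<in> borel_measurable M"
  using borel_measurable_continuous_onI[OF continuous_eexp_cpowr[OF assms(2)]]
    measurable_cong_sets[OF assms(1) refl] by blast

lemma integrable_eexp_cpowr:
  assumes "borel_prob M" "Re z > 0"
  shows "integrable M (\<lambda>y. complex_of_real (eexp y) powr z)"
proof -
  interpret prob_space M using assms by (simp add: borel_prob_def)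
  show ?thesis
    using assms norm_eexp_cpowr_le_1[OF assms(2)]
    by (intro integrable_const_bound[where B=1] measurable_eexp_cpowr) (auto simp: borel_prob_def)
qed

lemma claplace_of_real:
  "claplace M (complex_of_real \<theta>) = complex_of_real (\<integral>y. eexp y powr \<theta> \<partial>M)"
  unfolding claplace_def by (simp add: powr_of_real)

lemma claplace_lipschitz:
  assumes M: "borel_prob M" and c: "c > 0" "Re z \<ge> c" "Re w \<ge> c"
  shows "norm (claplace M z - claplace M w) \<le> 1 / c * norm (z - w)"
proof -
  interpret prob_space M using M by (simp add: borel_prob_def)
  have z: "Re z > 0" and w: "Re w > 0" using c by auto
  have "claplace M z - claplace M w = (\<integral>y. complex_of_real (eexp y) powr z - complex_of_real (eexp y) powr w \<partial>M)"
    unfolding claplace_def using integrable_eexp_cpowr[OF M z] integrable_eexp_cpowr[OF M w] by simp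
  also have "norm \<dots> \<le> (\<integral>y. norm (complex_of_real (eexp y) powr z - complex_of_real (eexp y) powr w) \<partial>M)"
    by (rule integral_norm_bound)
  also have "\<dots> \<le> (\<integral>y. 1 / c * norm (z - w) \<partial>M)"
    using integrable_eexp_cpowr[OF M z] integrable_eexp_cpowr[OF M w] c
    by (intro integral_mono powr_exponent_lipschitz) auto
  finally show ?thesis by (simp add: prob_space)
qed

lemma norm_claplace_le:
  assumes M: "borel_prob M" and z: "Re z > 0"
  shows "norm (claplace M z) \<le> (\<integral>y. eexp y powr Re z \<partial>M)"
proof -
  have "norm (claplace M z) \<le> (\<integral>y. norm (complex_of_real (eexp y) powr z) \<partial>M)"
    unfolding claplace_def by (rule integral_norm_bound)
  then show ?thesis by (simp add: norm_powr_real_powr)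
qed

text \<open>Differentiation under the integral: with c = Re z / 2 the Lipschitz constant 1/c
  dominates all difference quotients on Re w > c.\<close>

lemma claplace_holomorphic:
  assumes M: "borel_prob M"
  shows "claplace M holomorphic_on RHP"
proof (subst holomorphic_on_open[OF open_RHP], rule ballI)
  fix z assume "z \<in> RHP"
  then have z: "Re z > 0" by (simp add: RHP_def)
  interpret prob_space M using M by (simp add: borel_prob_def)
  have sets: "sets M = sets borel" using M by (simp add: borel_prob_def)
  define c where "c = Re z / 2"
  have c: "c > 0" "Re z > c" using z by (auto simp: c_def)
  let ?S = "{w. Re w > c}"
  let ?g = "\<lambda>w y. complex_of_real (eexp y) powr w"
  let ?D = "\<lambda>y. Ln (complex_of_real (eexp y)) * ?g z y"
  have "(claplace M has_field_derivative (\<integral>y. ?D y \<partial>M)) (at z within ?S)"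
    unfolding has_field_derivative_iff tendsto_at_iff_sequentially
  proof (intro allI impI)
    fix X assume X: "\<forall>i. X i \<in> ?S - {z}" "X \<longlonglongrightarrow> z"
    have Xz: "X i \<noteq> z" and XRe: "Re (X i) > c" for i using X by auto
    have XRe0: "Re (X i) > 0" for i using XRe[of i] c by linarith
    have quot: "(\<lambda>y. (?g (X i) y - ?g z y) / (X i - z)) \<in> borel_measurable M" for i
      by (intro borel_measurable_divide borel_measurable_diff measurable_eexp_cpowr sets XRe0 z) auto
    have lim: "(\<lambda>i. (?g (X i) y - ?g z y) / (X i - z)) \<longlonglongrightarrow> ?D y" for y
    proof (cases "eexp y = 0")
      case False
      then have "((\<lambda>w. ?g w y) has_field_derivative ?D y) (at z)"
        by (intro has_field_derivative_powr_right) auto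
      then have "((\<lambda>w. (?g w y - ?g z y) / (w - z)) \<longlongrightarrow> ?D y) (at z)"
        by (simp add: has_field_derivative_iff)
      then have "((\<lambda>w. (?g w y - ?g z y) / (w - z)) \<circ> X) \<longlonglongrightarrow> ?D y"
        using X(2) Xz unfolding tendsto_at_iff_sequentially by auto
      then show ?thesis by (simp add: comp_def)
    qed simp
    have "(\<lambda>i. \<integral>y. (?g (X i) y - ?g z y) / (X i - z) \<partial>M) \<longlonglongrightarrow> (\<integral>y. ?D y \<partial>M)"
    proof (rule integral_dominated_convergence[where w="\<lambda>_. 1 / c"])
      show "?D \<in> borel_measurable M"
        by (rule borel_measurable_LIMSEQ_metric[OF quot lim])
      show "AE y in M. norm ((?g (X i) y - ?g z y) / (X i - z)) \<le> 1 / c" for i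
      proof (rule AE_I2)
        fix y
        have "norm (?g (X i) y - ?g z y) \<le> 1 / c * norm (X i - z)"
          using c XRe[of i] by (intro powr_exponent_lipschitz) auto
        then show "norm ((?g (X i) y - ?g z y) / (X i - z)) \<le> 1 / c"
          using Xz[of i] by (simp add: norm_divide divide_le_eq)
      qed
    qed (auto simp: lim quot)
    moreover have "(\<integral>y. (?g (X i) y - ?g z y) / (X i - z) \<partial>M) = (claplace M (X i) - claplace M z) / (X i - z)" for i
      unfolding claplace_def
      using integrable_eexp_cpowr[OF M XRe0[of i]] integrable_eexp_cpowr[OF M z] by simp
    ultimately show "((\<lambda>y. (claplace M y - claplace M z) / (y - z)) \<circ> X) \<longlonglongrightarrow> (\<integral>y. ?D y \<partial>M)"
      by (simp only: comp_def)
  qed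
  then show "\<exists>f'. (claplace M has_field_derivative f') (at z)"
    using c by (auto simp: at_within_open[OF _ open_halfspace_Re_gt])
qed

lemma claplace_eq_exp:
  assumes M: "borel_prob M" and v: "v holomorphic_on RHP"
    and eq: "\<And>\<theta>. \<theta> > 0 \<Longrightarrow> complex_of_real (\<integral>y. eexp y powr \<theta> \<partial>M) = exp (- v (complex_of_real \<theta>))"
    and z: "z \<in> RHP"
  shows "claplace M z = exp (- v z)"
  by (rule RHP_identity[OF claplace_holomorphic[OF M] _ _ zero_less_one z])
     (auto intro!: holomorphic_intros v simp: claplace_of_real eq)

section \<open>The Laplace relation and kernel composition in terms of \<open>eexp\<close>\<close>

lemma laplace_integrand_eq:
  "\<theta> > 0 \<Longrightarrow> indicator {..<\<top>} y * exp (- \<theta> * enn2real y) = eexp y powr \<theta>"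
  by (cases y) (auto simp: eexp_def powr_def)

lemma laplace_relation_alt:
  "laplace_relation k v \<longleftrightarrow>
    (\<forall>(s, t) \<in> Delta. \<forall>x \<theta>. x > 0 \<and> \<theta> > 0 \<longrightarrow>
       complex_of_real (\<integral>y. eexp y powr \<theta> \<partial>k s t (ennreal x)) = exp (- complex_of_real x * v s t (complex_of_real \<theta>)))"
  unfolding laplace_relation_def using laplace_integrand_eq by (auto simp del: mult_minus_left)

lemma exp_eq_eexp_powr: "x \<ge> 0 \<Longrightarrow> exp (- (x * c)) = eexp (ennreal x) powr c"
  by (simp add: eexp_ennreal powr_def mult.commute)

lemma transition_kernel_prob: "transition_kernel K \<Longrightarrow> borel_prob (K x)"
  by (simp add: transition_kernel_def borel_prob_def)

lemma transition_kernel_measurable: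
  "transition_kernel K \<Longrightarrow> K \<in> measurable borel (subprob_algebra borel)"
  unfolding transition_kernel_def
  by (intro measurable_subprob_algebra) (auto intro: prob_space_imp_subprob_space)

text \<open>The bound 0 \<le> g \<le> 1 permits a detour through nonnegative integrals, where the
  formula for a bind applies. The inner integral is named h so that its closed form supplies its
  measurability.\<close>

lemma integral_kernel_composition:
  assumes K: "transition_kernel K" and M: "borel_prob M"
    and g: "g \<in> borel_measurable borel" "\<And>y. 0 \<le> g y" "\<And>y. g y \<le> (1::real)"
    and h: "h \<in> borel_measurable borel" "\<And>y. (\<integral>z. g z \<partial>K y) = h y"
  shows "(\<integral>y. g y \<partial>(M \<bind> K)) = (\<integral>y. h y \<partial>M)"
proof -
  have sets[measurable_cong]: "sets M = sets borel" using M by (simp add: borel_prob_def)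
  have K'[measurable]: "K \<in> measurable M (subprob_algebra borel)"
    using transition_kernel_measurable[OF K] by simp
  have setsb: "sets (M \<bind> K) = sets borel"
    using M by (intro sets_bind) (use K sets_eq_imp_space_eq[OF sets] in \<open>auto simp: transition_kernel_def\<close>)
  have gm: "g \<in> borel_measurable (M \<bind> K)" and hm: "h \<in> borel_measurable M"
    using g(1) h(1) measurable_cong_sets[OF setsb refl] measurable_cong_sets[OF sets refl] by blast+
  have inner: "(\<integral>\<^sup>+ z. ennreal (g z) \<partial>K y) = ennreal (h y)" for y
  proof -
    interpret prob_space "K y" using K by (simp add: transition_kernel_def)
    have "sets (K y) = sets borel" using K by (simp add: transition_kernel_def)
    then have "g \<in> borel_measurable (K y)"
      using g(1) measurable_cong_sets[OF _ refl] by blast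
    then have "integrable (K y) g"
      using g by (intro integrable_const_bound[where B=1]) auto
    then show ?thesis using g h by (simp add: nn_integral_eq_integral)
  qed
  have h0: "h y \<ge> 0" for y
    using h(2)[of y] g(2) by (metis Bochner_Integration.integral_nonneg)
  have "(\<integral>y. g y \<partial>(M \<bind> K)) = enn2real (\<integral>\<^sup>+ y. ennreal (g y) \<partial>(M \<bind> K))"
    using g gm by (intro integral_eq_nn_integral) auto
  also have "(\<integral>\<^sup>+ y. ennreal (g y) \<partial>(M \<bind> K)) = (\<integral>\<^sup>+ y. ennreal (h y) \<partial>M)"
    using g(1) by (subst nn_integral_bind[where B=borel]) (auto simp: inner)
  also have "enn2real \<dots> = (\<integral>y. h y \<partial>M)"
    using h0 hm by (intro integral_eq_nn_integral[symmetric]) auto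
  finally show ?thesis .
qed

lemma borel_prob_bind:
  assumes K: "transition_kernel K" and M: "borel_prob M"
  shows "borel_prob (M \<bind> K)"
    and "B \<in> sets borel \<Longrightarrow> emeasure (M \<bind> K) B = (\<integral>\<^sup>+ y. emeasure (K y) B \<partial>M)"
proof -
  have sets: "sets M = sets borel" and "prob_space M" using M by (auto simp: borel_prob_def)
  interpret prob_space M by fact
  have K': "K \<in> measurable M (subprob_algebra borel)"
    using transition_kernel_measurable[OF K] measurable_cong_sets[OF sets refl] by blast
  have "prob_space (M \<bind> K)"
    by (rule prob_space_bind[OF _ K']) (use K in \<open>auto simp: transition_kernel_def\<close>)
  moreover have "sets (M \<bind> K) = sets borel"
    by (intro sets_bind) (use K not_empty in \<open>auto simp: transition_kernel_def\<close>)
  ultimately show "borel_prob (M \<bind> K)" by (simp add: borel_prob_def)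
  show "B \<in> sets borel \<Longrightarrow> emeasure (M \<bind> K) B = (\<integral>\<^sup>+ y. emeasure (K y) B \<partial>M)"
    by (rule emeasure_bind[OF not_empty K'])
qed

section \<open>From kernels to evolution families\<close>

text \<open>Near a reference parameter the quotient of two transforms is close to 1 on a compact convex
  set through 1, so its principal logarithm is the difference of the exponents.\<close>
lemma laplace_exponent_locally_uniform:
  fixes M :: "'p::metric_space \<Rightarrow> ennreal measure"
  assumes M: "\<And>p. p \<in> P \<Longrightarrow> borel_prob (M p)"
    and hol: "\<And>p. p \<in> P \<Longrightarrow> v p holomorphic_on RHP"
    and eq: "\<And>p z. p \<in> P \<Longrightarrow> z \<in> RHP \<Longrightarrow> claplace (M p) z = exp (- v p z)"
    and real: "\<And>p. p \<in> P \<Longrightarrow> Im (v p 1) = 0"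
    and cont: "\<And>z. z \<in> RHP \<Longrightarrow> continuous_on P (\<lambda>p. claplace (M p) z)"
    and p0: "p0 \<in> P" and K: "compact K" "K \<subseteq> RHP" and \<epsilon>: "\<epsilon> > 0"
  shows "\<forall>\<^sub>F p in at p0 within P. \<forall>z\<in>K. dist (v p z) (v p0 z) < \<epsilon>"
proof -
  \<comment> \<open>Convexity makes a function with zero derivative constant, and the point 1 fixes
    that constant.\<close>
  define K' where "K' = convex hull (insert 1 K)"
  have "1 \<in> RHP" by (simp add: RHP_def)
  then have "K' \<subseteq> RHP"
    unfolding K'_def using K convex_RHP by (intro hull_minimal) auto
  then have K': "compact K'" "convex K'" "K \<subseteq> K'" "1 \<in> K'" "K' \<subseteq> RHP"
    unfolding K'_def using K
    by (auto intro!: compact_convex_hull hull_inc compact_insert convex_convex_hull)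
  obtain c where c: "c > 0" "\<And>z. z \<in> K' \<Longrightarrow> Re z \<ge> c"
  proof -
    have "K' \<noteq> {}" "continuous_on K' Re" using K' by (auto intro: continuous_intros)
    from continuous_attains_inf[OF K'(1) this] obtain z where "z \<in> K'" "\<And>w. w \<in> K' \<Longrightarrow> Re z \<le> Re w"
      by blast
    then show ?thesis using K'(5) by (intro that[of "Re z"]) (auto simp: RHP_def)
  qed
  obtain m where m: "m > 0" "\<And>z. z \<in> K' \<Longrightarrow> norm (claplace (M p0) z) \<ge> m"
  proof -
    have "K' \<noteq> {}" "continuous_on K' (\<lambda>z. norm (claplace (M p0) z))"
      using K' claplace_holomorphic[OF M[OF p0]]
      by (auto intro!: continuous_intros dest: holomorphic_on_imp_continuous_on continuous_on_subset)
    from continuous_attains_inf[OF K'(1) this] obtain z where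
      z: "z \<in> K'" "\<And>w. w \<in> K' \<Longrightarrow> norm (claplace (M p0) z) \<le> norm (claplace (M p0) w)" by blast
    moreover have "norm (claplace (M p0) z) > 0"
      using z K'(5) eq[OF p0, of z] by auto
    ultimately show ?thesis by (intro that)
  qed
  \<comment> \<open>The bound d \<le> 1 keeps the quotient of transforms in the right half-plane,
    away from the cut of \<open>Ln\<close>.\<close>
  obtain d where d: "d > 0" "d \<le> 1" "\<And>R. norm (R - 1) < d \<Longrightarrow> norm (Ln R) < \<epsilon>"
  proof -
    have "isCont Ln 1" by (intro continuous_at_Ln) auto
    then obtain d where "d > 0" "\<And>R. dist R 1 < d \<Longrightarrow> dist (Ln R) (Ln 1) < \<epsilon>"
      using \<epsilon> unfolding continuous_at_eps_delta by blast
    then show ?thesis by (intro that[of "min d 1"]) (auto simp: dist_norm)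
  qed
  \<comment> \<open>An absolute error \<eta> between transforms becomes a relative error d after
    division by a transform of modulus at least m.\<close>
  define \<eta> where "\<eta> = d * m"
  have \<eta>: "\<eta> > 0" using d m by (simp add: \<eta>_def)
  have "\<eta> * c / 3 > 0" using \<eta> c by simp
  \<comment> \<open>A finite net turns pointwise convergence into uniform convergence: with
    Lipschitz constant 1/c this mesh costs \<eta>/3 per move to the net, for both parameters,
    leaving \<eta>/3 for the error on the net.\<close>
  then obtain A where A: "finite A" "A \<subseteq> K'" "K' \<subseteq> (\<Union>x\<in>A. ball x (\<eta> * c / 3))"
    using seq_compact_imp_totally_bounded[OF compact_imp_seq_compact[OF K'(1)]] by metis
  have "\<forall>\<^sub>F p in at p0 within P. \<forall>a\<in>A. dist (claplace (M p) a) (claplace (M p0) a) < \<eta> / 3"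
  proof (rule eventually_ball_finite[OF A(1)], rule ballI)
    fix a assume "a \<in> A"
    then have "continuous_on P (\<lambda>p. claplace (M p) a)" using A K' by (intro cont) auto
    then have "((\<lambda>p. claplace (M p) a) \<longlongrightarrow> claplace (M p0) a) (at p0 within P)"
      using p0 by (auto simp: continuous_on_def)
    then show "\<forall>\<^sub>F p in at p0 within P. dist (claplace (M p) a) (claplace (M p0) a) < \<eta> / 3"
      using \<eta> by (intro tendstoD) auto
  qed
  moreover have "\<forall>\<^sub>F p in at p0 within P. p \<in> P"
    by (simp add: eventually_at_filter)
  ultimately show ?thesis
  proof eventually_elim
    case (elim p)
    note p = elim(2)
    define w where "w z = v p z - v p0 z" for z
    have close: "norm (exp (- w z) - 1) < d" if z: "z \<in> K'" for z
    proof -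
      obtain a where a: "a \<in> A" "dist a z < \<eta> * c / 3" using A(3) z by auto
      have lip: "dist (claplace (M q) z) (claplace (M q) a) < \<eta> / 3" if "q \<in> P" for q
      proof -
        have "dist (claplace (M q) z) (claplace (M q) a) \<le> 1 / c * norm (z - a)"
          unfolding dist_norm using c z a A(2) by (intro claplace_lipschitz M that) auto
        also have "\<dots> < 1 / c * (\<eta> * c / 3)"
          using a c by (intro mult_strict_left_mono) (auto simp: dist_norm norm_minus_commute)
        also have "\<dots> = \<eta> / 3" using c by simp
        finally show ?thesis .
      qed
      have "dist (claplace (M p) z) (claplace (M p0) z)
         \<le> dist (claplace (M p) z) (claplace (M p) a) + dist (claplace (M p) a) (claplace (M p0) a)
          + dist (claplace (M p0) z) (claplace (M p0) a)"
        by metric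
      also have "\<dots> < \<eta>" using lip[OF p] lip[OF p0] elim(1) a(1) by fastforce
      finally have lt: "norm (claplace (M p) z - claplace (M p0) z) < \<eta>" by (simp add: dist_norm)
      have zR: "z \<in> RHP" using z K' by auto
      have "exp (- w z) - 1 = (claplace (M p) z - claplace (M p0) z) / claplace (M p0) z"
        using exp_diff[of "- v p z" "- v p0 z"]
        by (simp add: eq[OF p zR] eq[OF p0 zR] w_def diff_divide_distrib)
      then have "norm (exp (- w z) - 1) = norm (claplace (M p) z - claplace (M p0) z) / norm (claplace (M p0) z)"
        by (simp add: norm_divide)
      also have "\<dots> \<le> norm (claplace (M p) z - claplace (M p0) z) / m"
        using m(1) m(2)[OF z] by (intro divide_left_mono mult_pos_pos) auto
      also have "\<dots> < \<eta> / m" using lt m by (intro divide_strict_right_mono) auto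
      also have "\<dots> = d" using m by (simp add: \<eta>_def)
      finally show ?thesis .
    qed
    \<comment> \<open>This sum is a multiple of 2 \<pi> i at each point. It is constant since its
      derivative is 0, and it vanishes at 1, where w is real.\<close>
    have "\<exists>b. \<forall>z\<in>K'. Ln (exp (- w z)) + w z = b"
    proof (rule has_field_derivative_zero_constant[OF K'(2)])
      fix z assume z: "z \<in> K'"
      then have zR: "z \<in> RHP" using K' by auto
      have "w holomorphic_on RHP" unfolding w_def by (intro holomorphic_intros hol p p0)
      then obtain w' where w': "(w has_field_derivative w') (at z)"
        using zR open_RHP by (auto simp: holomorphic_on_open)
      have "\<bar>Re (exp (- w z) - 1)\<bar> < 1"
        using close[OF z] d(2) abs_Re_le_cmod[of "exp (- w z) - 1"] by linarith
      then have "Re (exp (- w z)) > 0" by (simp add: abs_if split: if_splits)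
      then have nonpos: "exp (- w z) \<notin> \<real>\<^sub>\<le>\<^sub>0" by (auto simp: complex_nonpos_Reals_iff)
      have "((\<lambda>z. exp (- w z)) has_field_derivative exp (- w z) * - w') (at z)"
        by (auto intro!: derivative_eq_intros w')
      from DERIV_add[OF DERIV_chain2[OF has_field_derivative_Ln[OF nonpos] this] w']
      have "((\<lambda>z. Ln (exp (- w z)) + w z) has_field_derivative 0) (at z)"
        by (simp flip: mult.assoc)
      then show "((\<lambda>z. Ln (exp (- w z)) + w z) has_field_derivative 0) (at z within K')"
        by (rule has_field_derivative_at_within)
    qed
    then obtain b where b: "\<And>z. z \<in> K' \<Longrightarrow> Ln (exp (- w z)) + w z = b" by blast
    have "Im (w 1) = 0" using real[OF p] real[OF p0] by (simp add: w_def)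
    then have "Ln (exp (- w 1)) + w 1 = 0" by (subst Ln_exp) auto
    then have "b = 0" using b[OF K'(4)] by simp
    show ?case
    proof
      fix z assume "z \<in> K"
      then have z: "z \<in> K'" using K' by auto
      have "w z = - Ln (exp (- w z))" using b[OF z] \<open>b = 0\<close> by (simp add: add_eq_0_iff)
      then have "norm (w z) = norm (Ln (exp (- w z)))" by (metis norm_minus_cancel)
      also have "\<dots> < \<epsilon>" by (rule d(3)[OF close[OF z]])
      finally show "dist (v p z) (v p0 z) < \<epsilon>" by (simp add: w_def dist_norm)
    qed
  qed
qed

lemma branching_kernels_transition: "branching_kernels k \<Longrightarrow> (s, t) \<in> Delta \<Longrightarrow> transition_kernel (k s t)"
  unfolding branching_kernels_def by blast

lemma branching_kernels_refl: "branching_kernels k \<Longrightarrow> 0 \<le> s \<Longrightarrow> k s s x = return borel x"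
  unfolding branching_kernels_def by blast

lemma branching_kernels_0: "branching_kernels k \<Longrightarrow> (s, t) \<in> Delta \<Longrightarrow> k s t 0 = return borel 0"
  unfolding branching_kernels_def by blast

lemma branching_kernels_top: "branching_kernels k \<Longrightarrow> (s, t) \<in> Delta \<Longrightarrow> k s t \<top> = return borel \<top>"
  unfolding branching_kernels_def by blast

lemma branching_kernels_bind:
  assumes k: "branching_kernels k" and st: "0 \<le> s" "s \<le> t" "t \<le> u"
  shows "k s u x = k s t x \<bind> k t u"
proof (rule measure_eqI)
  have D: "(s, t) \<in> Delta" "(t, u) \<in> Delta" "(s, u) \<in> Delta" using st by (auto simp: Delta_def)
  note tk = branching_kernels_transition[OF k]
  have sets: "sets (k s u x) = sets borel"
    using transition_kernel_prob[OF tk[OF D(3)]] by (simp add: borel_prob_def)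
  show "sets (k s u x) = sets (k s t x \<bind> k t u)"
    using borel_prob_bind(1)[OF tk[OF D(2)] transition_kernel_prob[OF tk[OF D(1)]], of x] sets
    by (simp add: borel_prob_def)
  fix B assume "B \<in> sets (k s u x)"
  then have B: "B \<in> sets borel" using sets by simp
  have "emeasure (k s u x) B = (\<integral>\<^sup>+ y. emeasure (k t u y) B \<partial>(k s t x))"
    using k st B unfolding branching_kernels_def by blast
  then show "emeasure (k s u x) B = emeasure (k s t x \<bind> k t u) B"
    using borel_prob_bind(2)[OF tk[OF D(2)] transition_kernel_prob[OF tk[OF D(1)]] B] by simp
qed

lemma integral_eexp_powr_return [simp]: "(\<integral>y. eexp y powr \<theta> \<partial>return borel x) = eexp x powr \<theta>"
  by (subst integral_return) auto

lemma laplace_real: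
  assumes "laplace_relation k v" "(s, t) \<in> Delta" "x > 0" "\<theta> > 0"
    and "v s t (complex_of_real \<theta>) = complex_of_real c"
  shows "(\<integral>y. eexp y powr \<theta> \<partial>k s t (ennreal x)) = exp (- (x * c))"
proof -
  have "complex_of_real (\<integral>y. eexp y powr \<theta> \<partial>k s t (ennreal x)) = exp (- complex_of_real x * v s t (complex_of_real \<theta>))"
    using assms unfolding laplace_relation_alt by blast
  also have "\<dots> = complex_of_real (exp (- (x * c)))"
    using assms(5) by (simp flip: of_real_mult of_real_minus exp_of_real)
  finally show ?thesis by (simp only: of_real_eq_iff)
qed

text \<open>The Laplace relation speaks only of states in (0,\<infinity>). At 0 and \<infinity>,
  (K5) and (K6) make both sides 1 and 0, so the formula can be integrated over all intermediate
  states.\<close>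

lemma branching_laplace_all:
  assumes k: "branching_kernels k" and "laplace_relation k v" "(s, t) \<in> Delta" "\<theta> > 0"
    and "v s t (complex_of_real \<theta>) = complex_of_real c" "c > 0"
  shows "(\<integral>y. eexp y powr \<theta> \<partial>k s t x) = eexp x powr c"
proof (cases x)
  case (real r)
  then show ?thesis
    using laplace_real[OF assms(2,3) _ assms(4,5), of r] assms branching_kernels_0[OF k assms(3)]
    by (cases "r = 0") (auto simp: exp_eq_eexp_powr)
next
  case top
  then show ?thesis using assms branching_kernels_top[OF k assms(3)] by simp
qed

locale branching_process =
  fixes k :: "real \<Rightarrow> real \<Rightarrow> ennreal \<Rightarrow> ennreal measure" and v :: "real \<Rightarrow> real \<Rightarrow> complex \<Rightarrow> complex"
  assumes k: "branching_kernels k"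
    and ext: "\<And>s t. (s, t) \<in> Delta \<Longrightarrow> ext_bernstein (v s t)"
    and lap: "laplace_relation k v"
begin

definition \<phi> :: "real \<Rightarrow> real \<Rightarrow> real \<Rightarrow> real" where
  "\<phi> s t \<theta> = Re (v s t (complex_of_real \<theta>))"

lemma v_holomorphic: "(s, t) \<in> Delta \<Longrightarrow> v s t holomorphic_on RHP"
  using ext by (simp add: ext_bernstein_def)

lemma v_bernstein:
  assumes "(s, t) \<in> Delta"
  shows "\<exists>f. bernstein_function f \<and> (\<forall>x>0. v s t (complex_of_real x) = complex_of_real (f x)) \<and> (\<forall>x>0. \<phi> s t x = f x)"
  using ext[OF assms] by (auto simp: ext_bernstein_def \<phi>_def)

lemma v_of_real:
  assumes "(s, t) \<in> Delta" "\<theta> > 0"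
  shows "v s t (complex_of_real \<theta>) = complex_of_real (\<phi> s t \<theta>)"
  using v_bernstein[OF assms(1)] assms(2) by auto

lemma \<phi>_nonneg: "(s, t) \<in> Delta \<Longrightarrow> \<theta> > 0 \<Longrightarrow> \<phi> s t \<theta> \<ge> 0"
  using v_bernstein[of s t] bernstein_nonneg by fastforce

lemma \<phi>_mono: "(s, t) \<in> Delta \<Longrightarrow> 0 < a \<Longrightarrow> a \<le> b \<Longrightarrow> \<phi> s t a \<le> \<phi> s t b"
  using v_bernstein[of s t] bernstein_mono[of _ a b] by auto

text \<open>A nonnegative increasing function with a zero vanishes everywhere below it; the identity
  theorem spreads this to the half-plane.\<close>

lemma \<phi>_zero:
  assumes "(s, t) \<in> Delta" "\<theta>\<^sub>0 > 0" "\<phi> s t \<theta>\<^sub>0 = 0" "\<theta> > 0"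
  shows "\<phi> s t \<theta> = 0"
proof -
  have "\<phi> s t x = 0" if "0 < x" "x < \<theta>\<^sub>0" for x
    using \<phi>_nonneg[OF assms(1) that(1)] \<phi>_mono[OF assms(1) that(1), of \<theta>\<^sub>0] that assms(3) by simp
  then have zero: "v s t (complex_of_real x) = 0" if "0 < x" "x < \<theta>\<^sub>0" for x
    using v_of_real[OF assms(1)] that by simp
  have "v s t (complex_of_real \<theta>) = 0"
    by (rule RHP_identity[OF v_holomorphic[OF assms(1)] holomorphic_on_const zero assms(2)])
       (simp_all add: assms)
  then show ?thesis by (simp add: \<phi>_def)
qed

lemma borel_prob_k: "(s, t) \<in> Delta \<Longrightarrow> borel_prob (k s t x)"
  using transition_kernel_prob branching_kernels_transition[OF k] by blast

lemma laplace_at_1: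
  assumes "(s, t) \<in> Delta" "\<theta> > 0"
  shows "(\<integral>y. eexp y powr \<theta> \<partial>k s t 1) = exp (- \<phi> s t \<theta>)"
  using laplace_real[OF lap assms(1) zero_less_one assms(2) v_of_real[OF assms]] by simp

lemma claplace_k:
  assumes "(s, t) \<in> Delta" "z \<in> RHP"
  shows "claplace (k s t 1) z = exp (- v s t z)"
  by (rule claplace_eq_exp[OF borel_prob_k v_holomorphic _ assms(2)])
     (use assms in \<open>auto simp: laplace_at_1 v_of_real exp_of_real simp flip: of_real_minus\<close>)

lemma continuous_claplace_k:
  assumes "z \<in> RHP"
  shows "continuous_on Delta (\<lambda>p. claplace (k (fst p) (snd p) 1) z)"
proof -
  have z: "Re z > 0" using assms by (simp add: RHP_def)
  have K3: "continuous_on Delta (\<lambda>p. \<integral>y. f y \<partial>k (fst p) (snd p) 1)"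
    if f: "continuous_on UNIV f" for f :: "ennreal \<Rightarrow> real"
  proof -
    have "continuous_on {(s, t, x). (s, t) \<in> Delta \<and> x \<noteq> \<top>} (\<lambda>(s, t, x). \<integral>y. f y \<partial>k s t x)"
      using k f unfolding branching_kernels_def by blast
    then have "continuous_on Delta ((\<lambda>(s, t, x). \<integral>y. f y \<partial>k s t x) \<circ> (\<lambda>p. (fst p, snd p, 1)))"
      by (intro continuous_on_compose continuous_intros) (auto elim!: continuous_on_subset)
    then show ?thesis by (simp add: comp_def)
  qed
  let ?g = "\<lambda>y. complex_of_real (eexp y) powr z"
  have "continuous_on Delta (\<lambda>p. complex_of_real (\<integral>y. Re (?g y) \<partial>k (fst p) (snd p) 1)
     + \<i> * complex_of_real (\<integral>y. Im (?g y) \<partial>k (fst p) (snd p) 1))"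
    by (intro continuous_intros K3 continuous_eexp_cpowr z)
  moreover have "complex_of_real (\<integral>y. Re (?g y) \<partial>k (fst p) (snd p) 1)
     + \<i> * complex_of_real (\<integral>y. Im (?g y) \<partial>k (fst p) (snd p) 1) = claplace (k (fst p) (snd p) 1) z"
    if "p \<in> Delta" for p
    using integrable_eexp_cpowr[OF borel_prob_k z, of "fst p" "snd p" 1] that
    by (intro complex_eqI) (simp_all add: claplace_def)
  ultimately show ?thesis
    by (subst continuous_on_cong[OF refl]) auto
qed

lemma continuous_\<phi>:
  assumes "\<theta> > 0"
  shows "continuous_on Delta (\<lambda>p. \<phi> (fst p) (snd p) \<theta>)"
proof -
  have eq: "Re (claplace (k (fst p) (snd p) 1) (complex_of_real \<theta>)) = exp (- \<phi> (fst p) (snd p) \<theta>)"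
    if "p \<in> Delta" for p
    using that assms by (simp add: claplace_of_real laplace_at_1)
  have "continuous_on Delta (\<lambda>p. - ln (Re (claplace (k (fst p) (snd p) 1) (complex_of_real \<theta>))))"
    using assms by (intro continuous_intros continuous_claplace_k) (auto simp: eq)
  then show ?thesis
    by (subst (asm) continuous_on_cong[OF refl]) (auto simp: eq)
qed

lemma \<phi>_refl:
  assumes "0 \<le> s" "\<theta> > 0"
  shows "\<phi> s s \<theta> = \<theta>"
proof -
  have "exp (- \<phi> s s \<theta>) = eexp 1 powr \<theta>"
    using laplace_at_1[of s s \<theta>] assms branching_kernels_refl[OF k assms(1)] by (simp add: Delta_def)
  also have "\<dots> = exp (- \<theta>)" using exp_eq_eexp_powr[of 1 \<theta>] by simp
  finally show ?thesis by simp
qed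

text \<open>Chapman-Kolmogorov read on transforms: integrating out the second kernel replaces
  \<theta> by the inner exponent, which must be positive to serve as argument of the outer
  transform. Positivity stays a hypothesis because the proof of \<open>\<phi>_pos\<close> relies on
  this lemma.\<close>

lemma \<phi>_comp:
  assumes st: "0 \<le> s" "s \<le> t" "t \<le> u" and \<theta>: "\<theta> > 0" and pos: "\<phi> t u \<theta> > 0"
  shows "\<phi> s u \<theta> = \<phi> s t (\<phi> t u \<theta>)"
proof -
  have D: "(s, t) \<in> Delta" "(t, u) \<in> Delta" "(s, u) \<in> Delta" using st by (auto simp: Delta_def)
  have "exp (- \<phi> s u \<theta>) = (\<integral>y. eexp y powr \<theta> \<partial>(k s t 1 \<bind> k t u))"
    using laplace_at_1[OF D(3) \<theta>] branching_kernels_bind[OF k st] by simp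
  also have "\<dots> = (\<integral>y. eexp y powr \<phi> t u \<theta> \<partial>k s t 1)"
  proof (rule integral_kernel_composition)
    show "transition_kernel (k t u)" using branching_kernels_transition[OF k D(2)] .
    show "borel_prob (k s t 1)" by (rule borel_prob_k[OF D(1)])
    show "(\<integral>z. eexp z powr \<theta> \<partial>k t u y) = eexp y powr \<phi> t u \<theta>" for y
      by (rule branching_laplace_all[OF k lap D(2) \<theta> v_of_real[OF D(2) \<theta>] pos])
  qed (use \<theta> in \<open>auto simp: powr_le1\<close>)
  also have "\<dots> = exp (- \<phi> s t (\<phi> t u \<theta>))" by (rule laplace_at_1[OF D(1) pos])
  finally show ?thesis by simp
qed

text \<open>At the first time at which the exponent degenerates it would factor through two
  non-degenerate exponents, the inner one being close to the identity.\<close>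
lemma \<phi>_pos:
  assumes st: "(s, t) \<in> Delta" and \<theta>: "\<theta> > 0"
  shows "\<phi> s t \<theta> > 0"
proof (rule ccontr)
  assume "\<not> ?thesis"
  then have "\<phi> s t 1 = 0" using \<phi>_nonneg[OF assms] \<phi>_zero[OF assms] by simp
  define Z where "Z = {u \<in> {s..t}. \<phi> s u 1 = 0}"
  have s: "0 \<le> s" using st by (simp add: Delta_def)
  have "continuous_on {s..t} ((\<lambda>p. \<phi> (fst p) (snd p) 1) \<circ> (\<lambda>u. (s, u)))"
    using s by (intro continuous_on_compose continuous_intros continuous_on_subset[OF continuous_\<phi>])
      (auto simp: Delta_def)
  then have "closed Z"
    unfolding Z_def by (intro continuous_closed_preimage_constant) (simp_all add: comp_def)
  moreover have "t \<in> Z" using \<open>\<phi> s t 1 = 0\<close> st by (simp add: Z_def Delta_def)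
  moreover have bdd: "bdd_below Z" unfolding Z_def by (rule bdd_belowI[of _ s]) auto
  ultimately have "Inf Z \<in> Z" by (intro closed_contains_Inf) auto
  define t0 where "t0 = Inf Z"
  have t0: "s \<le> t0" "\<phi> s t0 1 = 0" using \<open>Inf Z \<in> Z\<close> by (auto simp: t0_def Z_def)
  have "t0 \<noteq> s" using t0 \<phi>_refl[OF s, of 1] by auto
  then have "s < t0" using t0 by simp
  have t0_le: "t0 \<le> t" using \<open>Inf Z \<in> Z\<close> by (simp add: t0_def Z_def)
  \<comment> \<open>Now the starting time varies: as u increases to t0, the exponent at 1 tends to
    its value 1 for the identity, so some u < t0 has a positive inner exponent.\<close>
  have "continuous_on {s..t0} ((\<lambda>p. \<phi> (fst p) (snd p) 1) \<circ> (\<lambda>u. (u, t0)))"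
    using s by (intro continuous_on_compose continuous_intros continuous_on_subset[OF continuous_\<phi>])
      (auto simp: Delta_def)
  then have "((\<lambda>u. \<phi> u t0 1) \<longlongrightarrow> \<phi> t0 t0 1) (at t0 within {s..t0})"
    using t0 by (auto simp: continuous_on_def comp_def)
  then have "\<forall>\<^sub>F u in at t0 within {s..t0}. \<phi> u t0 1 > 0"
    using \<phi>_refl[of t0 1] s t0 by (intro order_tendstoD) auto
  moreover have "\<forall>\<^sub>F u in at t0 within {s..t0}. u \<in> {s..t0} - {t0}"
    by (auto simp: eventually_at_filter)
  moreover have "at t0 within {s..t0} \<noteq> bot"
    using \<open>s < t0\<close> by (simp add: at_within_Icc_at_left)
  ultimately obtain u where u: "\<phi> u t0 1 > 0" "s \<le> u" "u < t0"
    using eventually_happens'[OF _ eventually_conj] by force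
  have Du: "(s, u) \<in> Delta" using u s by (simp add: Delta_def)
  \<comment> \<open>The exponent from s to u thus vanishes at a positive point, hence everywhere,
    which puts u below the infimum of Z.\<close>
  have "\<phi> s u (\<phi> u t0 1) = 0" using \<phi>_comp[OF s u(2) _ zero_less_one u(1)] u t0 by simp
  then have "\<phi> s u 1 = 0" using \<phi>_zero[OF Du u(1)] by simp
  then have "u \<in> Z" using u t0_le by (simp add: Z_def)
  then have "t0 \<le> u" unfolding t0_def using bdd by (intro cInf_lower)
  then show False using u by simp
qed

lemma v_in_BF: "(s, t) \<in> Delta \<Longrightarrow> v s t \<in> BF"
  using v_bernstein[of s t] v_holomorphic[of s t] \<phi>_pos[of s t 1] unfolding BF_def
  by (auto intro!: exI[of _ 1])

text \<open>The modulus of a transform at z is at most its value at Re z. Taking logarithms gives Re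
  v(z) \<ge> v(Re z), which is positive by \<open>\<phi>_pos\<close>.\<close>

lemma v_maps_RHP:
  assumes D: "(s, t) \<in> Delta" and z: "z \<in> RHP"
  shows "v s t z \<in> RHP"
proof -
  have Re: "Re z > 0" using z by (simp add: RHP_def)
  have "exp (- Re (v s t z)) = norm (claplace (k s t 1) z)"
    unfolding claplace_k[OF D z] by simp
  also have "\<dots> \<le> exp (- \<phi> s t (Re z))"
    using norm_claplace_le[OF borel_prob_k[OF D] Re, of 1] laplace_at_1[OF D Re] by simp
  finally have "\<phi> s t (Re z) \<le> Re (v s t z)" by simp
  then show ?thesis using \<phi>_pos[OF D Re] by (simp add: RHP_def)
qed

lemma v_refl:
  assumes "0 \<le> s" "z \<in> RHP"
  shows "v s s z = z"
proof (rule RHP_identity[OF v_holomorphic _ _ zero_less_one assms(2)])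
  show "(s, s) \<in> Delta" using assms by (simp add: Delta_def)
  then show "v s s (complex_of_real x) = complex_of_real x" if "0 < x" for x
    using v_of_real that \<phi>_refl[OF assms(1)] by simp
qed auto

lemma v_comp:
  assumes st: "0 \<le> s" "s \<le> t" "t \<le> u" and z: "z \<in> RHP"
  shows "v s u z = v s t (v t u z)"
proof -
  have D: "(s, t) \<in> Delta" "(t, u) \<in> Delta" "(s, u) \<in> Delta" using st by (auto simp: Delta_def)
  have "v s u z = (v s t \<circ> v t u) z"
  proof (rule RHP_identity[OF v_holomorphic[OF D(3)] _ _ zero_less_one z])
    show "(v s t \<circ> v t u) holomorphic_on RHP"
      by (rule holomorphic_on_compose_gen[OF v_holomorphic[OF D(2)] v_holomorphic[OF D(1)]])
         (use v_maps_RHP[OF D(2)] in auto)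
    show "v s u (complex_of_real x) = (v s t \<circ> v t u) (complex_of_real x)" if "0 < x" for x
      using v_of_real D that \<phi>_pos[OF D(2) that] \<phi>_comp[OF st that] by simp
  qed
  then show ?thesis by simp
qed

lemma v_lu_continuous: "lu_continuous_on Delta RHP v"
  unfolding lu_continuous_on_def
proof (intro ballI, clarify)
  fix s t :: real and K and \<epsilon> :: real
  assume D: "(s, t) \<in> Delta" and K: "compact K" "K \<subseteq> RHP" and \<epsilon>: "\<epsilon> > 0"
  have "\<forall>\<^sub>F p in at (s, t) within Delta. \<forall>z\<in>K. dist (v (fst p) (snd p) z) (v (fst (s, t)) (snd (s, t)) z) < \<epsilon>"
    by (rule laplace_exponent_locally_uniform[where M="\<lambda>p. k (fst p) (snd p) 1" and v="\<lambda>p. v (fst p) (snd p)"])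
       (use D K \<epsilon> v_of_real[where \<theta>=1] continuous_claplace_k in \<open>auto simp: borel_prob_k v_holomorphic intro: claplace_k\<close>)
  then obtain \<delta> where "\<delta> > 0" and \<delta>: "\<And>p. p \<in> Delta \<Longrightarrow> p \<noteq> (s, t) \<Longrightarrow> dist p (s, t) < \<delta> \<Longrightarrow>
      \<forall>z\<in>K. dist (v (fst p) (snd p) z) (v s t z) < \<epsilon>"
    unfolding eventually_at by auto
  have "\<forall>(s', t')\<in>Delta. dist (s', t') (s, t) < \<delta> \<longrightarrow> (\<forall>z\<in>K. dist (v s' t' z) (v s t z) < \<epsilon>)"
  proof clarify
    fix s' t' z assume "(s', t') \<in> Delta" "dist (s', t') (s, t) < \<delta>" "z \<in> K"
    then show "dist (v s' t' z) (v s t z) < \<epsilon>"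
      using \<delta>[of "(s', t')"] \<epsilon> by (cases "(s', t') = (s, t)") auto
  qed
  then show "\<exists>\<delta>>0. \<forall>(s', t')\<in>Delta. dist (s', t') (s, t) < \<delta> \<longrightarrow> (\<forall>z\<in>K. dist (v s' t' z) (v s t z) < \<epsilon>)"
    using \<open>\<delta> > 0\<close> by blast
qed

lemma v_top_rev_evolution_family: "top_rev_evolution_family RHP v"
  unfolding top_rev_evolution_family_def
  using v_holomorphic v_maps_RHP v_refl v_comp v_lu_continuous by blast

end

section \<open>From evolution families to kernels\<close>

lemma eexp_power_eq_powr:
  assumes "n > 0"
  shows "eexp y ^ n = eexp y powr real n"
proof (cases "eexp y = 0")
  case False
  then have "eexp y > 0" using eexp_nonneg[of y] by linarith
  then show ?thesis by (simp add: powr_realpow)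
qed (use assms in simp)

lemma measure_eqI_laplace:
  assumes "borel_prob M" "borel_prob N"
    and eq: "\<And>\<theta>. \<theta> > 0 \<Longrightarrow> (\<integral>y. eexp y powr \<theta> \<partial>M) = (\<integral>y. eexp y powr \<theta> \<partial>N)"
  shows "M = N"
proof (rule measure_eqI_moments)
  fix n :: nat assume n: "n > 0"
  then show "(\<integral>y. eexp y ^ n \<partial>M) = (\<integral>y. eexp y ^ n \<partial>N)"
    using eq[of "real n"] by (simp add: eexp_power_eq_powr)
qed (use assms in \<open>auto simp: borel_prob_def\<close>)

lemma borel_prob_return: "borel_prob (return borel x)"
  by (simp add: borel_prob_def prob_space_return)

text \<open>The measures are chosen separately for each state, so nothing is said yet about
  measurability in x; \<open>laplace_kernel_transition\<close> supplies it.\<close>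

lemma exists_laplace_kernel:
  assumes f: "bernstein_function f" and pos: "\<And>\<theta>. \<theta> > 0 \<Longrightarrow> f \<theta> > 0"
  shows "\<exists>K. \<forall>x. borel_prob (K x) \<and> (\<forall>\<theta>>0. (\<integral>y. eexp y powr \<theta> \<partial>K x) = eexp x powr f \<theta>)"
proof (rule choice, rule allI)
  fix x :: ennreal
  show "\<exists>M. borel_prob M \<and> (\<forall>\<theta>>0. (\<integral>y. eexp y powr \<theta> \<partial>M) = eexp x powr f \<theta>)"
  proof (cases x)
    case (real r)
    then show ?thesis
      using exists_measure_with_laplace_exponent[OF f, of r] by (simp add: borel_prob_def exp_eq_eexp_powr)
  next
    case top
    then show ?thesis
      using pos by (intro exI[of _ "return borel \<top>"]) (auto simp: borel_prob_return)
  qed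
qed

text \<open>Integrals of polynomials in \<open>eexp\<close> are finite combinations of moments,
  hence continuous in p. The approximation error is the same for all p, so the limit is uniform and
  continuity persists.\<close>

lemma continuous_kernel_integral:
  fixes K :: "'p::topological_space \<Rightarrow> ennreal measure" and f :: "ennreal \<Rightarrow> real"
  assumes K: "\<And>p. p \<in> S \<Longrightarrow> borel_prob (K p)"
    and cont: "\<And>n. n > 0 \<Longrightarrow> continuous_on S (\<lambda>p. \<integral>y. eexp y powr real n \<partial>K p)"
    and f: "continuous_on UNIV f"
  shows "continuous_on S (\<lambda>p. \<integral>y. f y \<partial>K p)"
proof -
  have mom: "continuous_on S (\<lambda>p. \<integral>y. eexp y ^ n \<partial>K p)" for n
  proof (cases "n = 0")
    case True
    have "(\<integral>y. eexp y ^ n \<partial>K p) = 1" if "p \<in> S" for p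
      using K[OF that] True by (simp add: borel_prob_def prob_space.prob_space)
    then show ?thesis by (subst continuous_on_cong[OF refl]) auto
  qed (use cont in \<open>simp add: eexp_power_eq_powr\<close>)
  have "\<forall>i. \<exists>a N. \<forall>y. \<bar>f y - (\<Sum>j\<le>N. a j * eexp y ^ j)\<bar> < inverse (real (Suc i))"
    by (intro allI eexp_polynomial_approx[OF f]) simp
  then obtain a N where approx: "\<And>i y. \<bar>f y - (\<Sum>j\<le>N i. a i j * eexp y ^ j)\<bar> < inverse (real (Suc i))"
    by metis
  define F where "F i p = (\<Sum>j\<le>N i. a i j * (\<integral>y. eexp y ^ j \<partial>K p))" for i p
  have bound: "dist (F i p) (\<integral>y. f y \<partial>K p) \<le> inverse (real (Suc i))" if "p \<in> S" for i p
    using integral_polynomial_approx[OF _ _ f approx, of "K p" i] K[OF that]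
    by (simp add: F_def dist_real_def abs_minus_commute borel_prob_def)
  show ?thesis
  proof (rule uniform_limit_theorem[where f=F and F=sequentially])
    show "\<forall>\<^sub>F i in sequentially. continuous_on S (F i)"
      unfolding F_def by (intro always_eventually allI continuous_intros mom)
    show "uniform_limit S F (\<lambda>p. \<integral>y. f y \<partial>K p) sequentially"
    proof (rule uniform_limitI)
      fix e :: real assume "e > 0"
      then obtain n where n: "inverse (real (Suc n)) < e" using reals_Archimedean by blast
      have "inverse (real (Suc i)) < e" if "i \<ge> n" for i
        by (rule le_less_trans[OF le_imp_inverse_le n]) (use that in auto)
      then show "\<forall>\<^sub>F i in sequentially. \<forall>p\<in>S. dist (F i p) (\<integral>y. f y \<partial>K p) < e"
        using bound by (auto simp: eventually_sequentially intro!: exI[of _ n] intro: le_less_trans)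
    qed
  qed simp
qed

lemma eexp_less_iff: "eexp a < eexp y \<longleftrightarrow> y < a"
  by (cases a; cases y) (auto simp: eexp_ennreal ennreal_less_iff)

lemma continuous_eexp_powr:
  assumes "c > 0"
  shows "continuous_on UNIV (\<lambda>y. eexp y powr c)"
  using assms by (intro continuous_on_powr' continuous_eexp continuous_on_const) auto

text \<open>Positive exponents make the transforms continuous in the state up to \<infinity>, hence
  also the integrals of continuous functions. Half-open rays are limits of such functions, generate
  the Borel sets and are stable under intersection.\<close>

lemma laplace_kernel_transition:
  assumes K: "\<And>x. borel_prob (K x)" and pos: "\<And>\<theta>. \<theta> > 0 \<Longrightarrow> f \<theta> > 0"
    and lap: "\<And>x \<theta>. \<theta> > 0 \<Longrightarrow> (\<integral>y. eexp y powr \<theta> \<partial>K x) = eexp x powr f \<theta>"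
  shows "transition_kernel K"
proof -
  have cont: "continuous_on UNIV (\<lambda>x. \<integral>y. g y \<partial>K x)" if "continuous_on UNIV g" for g :: "ennreal \<Rightarrow> real"
  proof (rule continuous_kernel_integral[OF K _ that])
    fix n :: nat assume "n > 0"
    then have "real n > 0" by simp
    then show "continuous_on UNIV (\<lambda>x. \<integral>y. eexp y powr real n \<partial>K x)"
      using continuous_eexp_powr[OF pos] by (simp only: lap)
  qed
  have Iio: "(\<lambda>x. emeasure (K x) {..<a}) \<in> borel_measurable borel" for a
  proof -
    \<comment> \<open>Capped ramps: \<open>eexp\<close> is strictly decreasing, so the difference is
      positive exactly for y < a, and the slope n drives g up to the indicator.\<close>
    define g where "g n y = min 1 (real n * max 0 (eexp y - eexp a))" for n y
    have gc: "continuous_on UNIV (g n)" for n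
      unfolding g_def by (intro continuous_intros continuous_eexp)
    have lim: "(\<lambda>n. g n y) \<longlonglongrightarrow> indicator {..<a} y" for y
    proof (cases "y < a")
      case True
      then have d: "eexp y - eexp a > 0" by (simp add: eexp_less_iff)
      have "\<forall>\<^sub>F n in sequentially. real n * (eexp y - eexp a) > 1"
        using d by real_asymp
      then have "\<forall>\<^sub>F n in sequentially. g n y = 1"
        by eventually_elim (use d in \<open>auto simp: g_def min_def max_def\<close>)
      then show ?thesis using True by (simp add: tendsto_eventually)
    next
      case False
      then have "eexp y \<le> eexp a" using eexp_less_iff[of a y] by simp
      then show ?thesis using False by (simp add: g_def max_def)
    qed
    have "(\<lambda>n. \<integral>y. g n y \<partial>K x) \<longlonglongrightarrow> measure (K x) {..<a}" for x
    proof -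
      interpret prob_space "K x" using K by (simp add: borel_prob_def)
      have sets: "sets (K x) = sets borel" using K by (simp add: borel_prob_def)
      have "(\<lambda>n. \<integral>y. g n y \<partial>K x) \<longlonglongrightarrow> (\<integral>y. indicator {..<a} y \<partial>K x)"
      proof (rule integral_dominated_convergence[where w="\<lambda>_. 1"])
        show "g n \<in> borel_measurable (K x)" for n
          using borel_measurable_continuous_onI[OF gc] measurable_cong_sets[OF sets refl] by blast
        show "indicator {..<a} \<in> borel_measurable (K x)"
          by (intro borel_measurable_indicator) (simp add: sets)
      qed (auto simp: lim, auto simp: g_def)
      then show ?thesis by (simp add: sets sets_eq_imp_space_eq[OF sets])
    qed
    then have "(\<lambda>x. measure (K x) {..<a}) \<in> borel_measurable borel"
      by (rule borel_measurable_LIMSEQ_real) (intro borel_measurable_continuous_onI cont gc)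
    then have "(\<lambda>x. ennreal (measure (K x) {..<a})) \<in> borel_measurable borel"
      by simp
    moreover have "ennreal (measure (K x) {..<a}) = emeasure (K x) {..<a}" for x
      using K by (simp add: borel_prob_def prob_space_def finite_measure.emeasure_eq_measure)
    ultimately show ?thesis by simp
  qed
  have "K \<in> measurable borel (prob_algebra borel)"
  proof (rule measurable_prob_algebra_generated[where \<Omega>=UNIV and G="range lessThan"])
    show "sets (borel :: ennreal measure) = sigma_sets UNIV (range lessThan)"
      by (subst borel_Iio) auto
    show "Int_stable (range (lessThan :: ennreal \<Rightarrow> _))"
      unfolding Int_stable_def
    proof clarify
      fix a b :: ennreal
      have "{..<a} \<inter> {..<b} = {..<min a b}" by auto
      then show "{..<a} \<inter> {..<b} \<in> range lessThan" by blast
    qed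
  qed (use K Iio in \<open>auto simp: borel_prob_def\<close>)
  then have "(\<lambda>x. emeasure (K x) B) \<in> borel_measurable borel" if "B \<in> sets borel" for B
    using measurable_emeasure_kernel[OF measurable_prob_algebraD that] by blast
  then show ?thesis using K by (auto simp: transition_kernel_def borel_prob_def)
qed

lemma borel_prob_conv:
  assumes M: "borel_prob M" and N: "borel_prob N"
  shows "borel_prob (conv_ennreal M N)"
    and "\<theta> > 0 \<Longrightarrow> (\<integral>y. eexp y powr \<theta> \<partial>conv_ennreal M N) = (\<integral>y. eexp y powr \<theta> \<partial>M) * (\<integral>y. eexp y powr \<theta> \<partial>N)"
proof -
  have sets[measurable_cong]: "sets M = sets borel" "sets N = sets borel"
    using M N by (auto simp: borel_prob_def)
  interpret M: prob_space M using M by (simp add: borel_prob_def)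
  interpret N: prob_space N using N by (simp add: borel_prob_def)
  interpret P: pair_prob_space M N ..
  have add[measurable]: "(\<lambda>(a, b). a + b) \<in> borel_measurable (M \<Otimes>\<^sub>M N)"
    by measurable
  show "borel_prob (conv_ennreal M N)"
    unfolding borel_prob_def conv_ennreal_def using P.prob_space_distr[OF add] by simp
  assume \<theta>: "\<theta> > 0"
  have int: "integrable (M \<Otimes>\<^sub>M N) (\<lambda>(a, b). eexp a powr \<theta> * eexp b powr \<theta>)"
    using \<theta> by (intro P.integrable_const_bound[where B=1] AE_I2) (auto intro!: mult_le_one simp: powr_le1)
  have "(\<integral>y. eexp y powr \<theta> \<partial>conv_ennreal M N) = (\<integral>p. eexp (case p of (a, b) \<Rightarrow> a + b) powr \<theta> \<partial>(M \<Otimes>\<^sub>M N))"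
    unfolding conv_ennreal_def by (rule integral_distr[OF add]) simp
  also have "\<dots> = (\<integral>p. (\<lambda>(a, b). eexp a powr \<theta> * eexp b powr \<theta>) p \<partial>(M \<Otimes>\<^sub>M N))"
    by (intro Bochner_Integration.integral_cong refl) (auto simp: eexp_add powr_mult)
  also have "\<dots> = (\<integral>a. \<integral>b. eexp a powr \<theta> * eexp b powr \<theta> \<partial>N \<partial>M)"
    using P.integral_fst'[OF int] by simp
  finally show "(\<integral>y. eexp y powr \<theta> \<partial>conv_ennreal M N) = (\<integral>y. eexp y powr \<theta> \<partial>M) * (\<integral>y. eexp y powr \<theta> \<partial>N)"
    by simp
qed

lemma lu_continuous_on_imp_continuous_at_point:
  assumes "lu_continuous_on P D v" "z \<in> D"
  shows "continuous_on P (\<lambda>p. v (fst p) (snd p) z)"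
  unfolding continuous_on_iff
proof (intro ballI allI impI)
  fix p and \<epsilon> :: real assume p: "p \<in> P" and \<epsilon>: "\<epsilon> > 0"
  obtain s t where st: "p = (s, t)" by (cases p)
  have "\<forall>K. compact K \<and> K \<subseteq> D \<longrightarrow> (\<forall>\<epsilon>>0. \<exists>\<delta>>0. \<forall>(s', t')\<in>P. dist (s', t') p < \<delta> \<longrightarrow>
      (\<forall>z\<in>K. dist (v s' t' z) (v s t z) < \<epsilon>))"
    using bspec[OF assms(1)[unfolded lu_continuous_on_def] p] by (simp add: st)
  from this[rule_format, of "{z}" \<epsilon>] obtain \<delta> where "\<delta> > 0"
    "\<And>s' t'. (s', t') \<in> P \<Longrightarrow> dist (s', t') p < \<delta> \<Longrightarrow> dist (v s' t' z) (v s t z) < \<epsilon>"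
    using assms(2) \<epsilon> by auto
  then show "\<exists>d>0. \<forall>q\<in>P. dist q p < d \<longrightarrow> dist (v (fst q) (snd q) z) (v (fst p) (snd p) z) < \<epsilon>"
    by (intro exI[of _ \<delta>]) (auto simp: st)
qed

text \<open>All kernel axioms except (K3) and the kernel property are equalities of measures, so
  comparing transforms reduces them to algebra with
  \<open>eexp x powr f s t \<theta>\<close>.\<close>

lemma branching_kernels_of_laplace:
  fixes v :: "real \<Rightarrow> real \<Rightarrow> complex \<Rightarrow> complex" and f :: "real \<Rightarrow> real \<Rightarrow> real \<Rightarrow> real"
    and k :: "real \<Rightarrow> real \<Rightarrow> ennreal \<Rightarrow> ennreal measure"
  assumes v: "top_rev_evolution_family RHP v"
    and real: "\<And>s t \<theta>. (s, t) \<in> Delta \<Longrightarrow> \<theta> > 0 \<Longrightarrow> v s t (complex_of_real \<theta>) = complex_of_real (f s t \<theta>)"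
    and pos: "\<And>s t \<theta>. (s, t) \<in> Delta \<Longrightarrow> \<theta> > 0 \<Longrightarrow> f s t \<theta> > 0"
    and prob: "\<And>s t x. (s, t) \<in> Delta \<Longrightarrow> borel_prob (k s t x)"
    and lap: "\<And>s t x \<theta>. (s, t) \<in> Delta \<Longrightarrow> \<theta> > 0 \<Longrightarrow> (\<integral>y. eexp y powr \<theta> \<partial>k s t x) = eexp x powr f s t \<theta>"
  shows "branching_kernels k"
proof -
  have tk: "transition_kernel (k s t)" if "(s, t) \<in> Delta" for s t
    using that by (intro laplace_kernel_transition[where f="f s t"] prob pos lap)
  have f_refl: "f s s \<theta> = \<theta>" if "0 \<le> s" "\<theta> > 0" for s \<theta>
  proof -
    have "v s s (complex_of_real \<theta>) = complex_of_real \<theta>"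
      using v that unfolding top_rev_evolution_family_def by simp
    then show ?thesis using real[of s s \<theta>] that by (simp add: Delta_def)
  qed
  have f_comp: "f s u \<theta> = f s t (f t u \<theta>)" if "0 \<le> s" "s \<le> t" "t \<le> u" "\<theta> > 0" for s t u \<theta>
  proof -
    have D: "(s, t) \<in> Delta" "(t, u) \<in> Delta" "(s, u) \<in> Delta" using that by (auto simp: Delta_def)
    have "v s u (complex_of_real \<theta>) = v s t (v t u (complex_of_real \<theta>))"
      using v that unfolding top_rev_evolution_family_def by simp
    then have "complex_of_real (f s u \<theta>) = complex_of_real (f s t (f t u \<theta>))"
      using real D pos that(4) by simp
    then show ?thesis by (simp only: of_real_eq_iff)
  qed
  have f_cont: "continuous_on Delta (\<lambda>p. f (fst p) (snd p) \<theta>)" if "\<theta> > 0" for \<theta>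
  proof -
    have "continuous_on Delta (\<lambda>p. v (fst p) (snd p) (complex_of_real \<theta>))"
      using v that unfolding top_rev_evolution_family_def
      by (intro lu_continuous_on_imp_continuous_at_point[where D=RHP]) auto
    then have "continuous_on Delta (\<lambda>p. Re (v (fst p) (snd p) (complex_of_real \<theta>)))"
      by (rule continuous_on_Re)
    then show ?thesis
      by (subst (asm) continuous_on_cong[OF refl]) (use real that in auto)
  qed
  show ?thesis
    unfolding branching_kernels_def
  proof (intro conjI)
    show "\<forall>(s, t)\<in>Delta. transition_kernel (k s t)" using tk by auto
    show "\<forall>s x. 0 \<le> s \<longrightarrow> k s s x = return borel x"
      by (auto intro!: measure_eqI_laplace prob borel_prob_return simp: lap f_refl Delta_def)
    show "\<forall>s t u x. 0 \<le> s \<and> s \<le> t \<and> t \<le> u \<longrightarrow>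
        (\<forall>B\<in>sets borel. emeasure (k s u x) B = (\<integral>\<^sup>+ y. emeasure (k t u y) B \<partial>k s t x))"
    proof (intro allI impI ballI, elim conjE)
      fix s t u :: real and x and B :: "ennreal set"
      assume st: "0 \<le> s" "s \<le> t" "t \<le> u" and B: "B \<in> sets borel"
      then have D: "(s, t) \<in> Delta" "(t, u) \<in> Delta" "(s, u) \<in> Delta" by (auto simp: Delta_def)
      have "k s u x = k s t x \<bind> k t u"
      proof (rule measure_eqI_laplace[OF prob[OF D(3)] borel_prob_bind(1)[OF tk[OF D(2)] prob[OF D(1)]]])
        fix \<theta> :: real assume \<theta>: "\<theta> > 0"
        have "(\<integral>y. eexp y powr \<theta> \<partial>(k s t x \<bind> k t u)) = (\<integral>y. eexp y powr f t u \<theta> \<partial>k s t x)"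
          by (rule integral_kernel_composition[OF tk[OF D(2)] prob[OF D(1)]])
             (use \<theta> in \<open>auto simp: lap[OF D(2)] powr_le1\<close>)
        then show "(\<integral>y. eexp y powr \<theta> \<partial>k s u x) = (\<integral>y. eexp y powr \<theta> \<partial>(k s t x \<bind> k t u))"
          using \<theta> D pos by (simp add: lap f_comp[OF st])
      qed
      then show "emeasure (k s u x) B = (\<integral>\<^sup>+ y. emeasure (k t u y) B \<partial>k s t x)"
        using borel_prob_bind(2)[OF tk[OF D(2)] prob[OF D(1)] B] by simp
    qed
    show "\<forall>g :: ennreal \<Rightarrow> real. continuous_on UNIV g \<longrightarrow>
        continuous_on {(s, t, x). (s, t) \<in> Delta \<and> x \<noteq> \<top>} (\<lambda>(s, t, x). \<integral>y. g y \<partial>k s t x)"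
    proof (intro allI impI)
      fix g :: "ennreal \<Rightarrow> real" assume g: "continuous_on UNIV g"
      let ?S = "{(s, t, x). (s, t) \<in> Delta \<and> x \<noteq> \<top>} :: (real \<times> real \<times> ennreal) set"
      have "continuous_on ?S (\<lambda>p. \<integral>y. g y \<partial>k (fst p) (fst (snd p)) (snd (snd p)))"
      proof (rule continuous_kernel_integral[OF _ _ g])
        show "borel_prob (k (fst p) (fst (snd p)) (snd (snd p)))" if "p \<in> ?S" for p
          using that by (auto intro: prob)
        fix n :: nat assume n: "n > 0"
        have "continuous_on ?S ((\<lambda>p. f (fst p) (snd p) (real n)) \<circ> (\<lambda>p. (fst p, fst (snd p))))"
          using n by (intro continuous_on_compose continuous_intros continuous_on_subset[OF f_cont]) auto
        then have fc: "continuous_on ?S (\<lambda>p. f (fst p) (fst (snd p)) (real n))"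
          by (simp add: comp_def)
        have "continuous_on ?S (eexp \<circ> (\<lambda>p. snd (snd p)))"
          by (intro continuous_on_compose continuous_intros continuous_on_subset[OF continuous_eexp]) auto
        then have ec: "continuous_on ?S (\<lambda>p. eexp (snd (snd p)))"
          by (simp add: comp_def)
        \<comment> \<open>On finite states the base is nonzero, which makes the power jointly
          continuous in base and exponent; this is where (K3) excludes the state
          \<infinity>.\<close>
        have "continuous_on ?S (\<lambda>p. eexp (snd (snd p)) powr f (fst p) (fst (snd p)) (real n))"
          using ec fc by (rule continuous_on_powr) (auto simp: eexp_def)
        then show "continuous_on ?S (\<lambda>p. \<integral>y. eexp y powr real n \<partial>k (fst p) (fst (snd p)) (snd (snd p)))"
          by (subst continuous_on_cong[OF refl]) (use n in \<open>auto simp: lap\<close>)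
      qed
      then show "continuous_on ?S (\<lambda>(s, t, x). \<integral>y. g y \<partial>k s t x)"
        by (simp add: case_prod_beta')
    qed
    show "\<forall>(s, t)\<in>Delta. \<forall>x y. x \<noteq> \<top> \<and> y \<noteq> \<top> \<longrightarrow> conv_ennreal (k s t x) (k s t y) = k s t (x + y)"
      by (auto intro!: measure_eqI_laplace borel_prob_conv(1) prob simp: borel_prob_conv(2)[OF prob prob] lap eexp_add powr_mult)
    show "\<forall>(s, t)\<in>Delta. k s t 0 = return borel 0"
      by (auto intro!: measure_eqI_laplace prob borel_prob_return simp: lap)
    show "\<forall>(s, t)\<in>Delta. k s t \<top> = return borel \<top>"
      by (auto intro!: measure_eqI_laplace prob borel_prob_return simp: lap)
  qed
qed

theorem exists_unique_branching_kernels: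
  assumes v: "top_rev_evolution_family RHP v" and BF: "\<And>s t. (s, t) \<in> Delta \<Longrightarrow> v s t \<in> BF"
  shows "\<exists>k. branching_kernels k \<and> laplace_relation k v \<and>
           (\<forall>k'. branching_kernels k' \<and> laplace_relation k' v \<longrightarrow> (\<forall>(s, t)\<in>Delta. \<forall>x. k' s t x = k s t x))"
proof -
  define f where "f s t \<theta> = Re (v s t (complex_of_real \<theta>))" for s t \<theta>
  have real: "v s t (complex_of_real \<theta>) = complex_of_real (f s t \<theta>)" if "(s, t) \<in> Delta" "\<theta> > 0" for s t \<theta>
    using BF[OF that(1)] that(2) by (auto simp: BF_def f_def)
  have pos: "f s t \<theta> > 0" if "(s, t) \<in> Delta" "\<theta> > 0" for s t \<theta>
  proof -
    have "v s t ` RHP \<subseteq> RHP" using v that unfolding top_rev_evolution_family_def by blast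
    then have "v s t (complex_of_real \<theta>) \<in> RHP" using that by (auto simp: image_subset_iff)
    then show ?thesis by (simp add: f_def RHP_def)
  qed
  have "\<exists>K. \<forall>x. borel_prob (K x) \<and> (\<forall>\<theta>>0. (\<integral>y. eexp y powr \<theta> \<partial>K x) = eexp x powr f (fst p) (snd p) \<theta>)"
    if "p \<in> Delta" for p
  proof -
    have D: "(fst p, snd p) \<in> Delta" using that by simp
    then obtain g where g: "bernstein_function g" "\<And>x. x > 0 \<Longrightarrow> v (fst p) (snd p) (complex_of_real x) = complex_of_real (g x)"
      using BF[OF D] unfolding BF_def by blast
    then have "g x = f (fst p) (snd p) x" if "x > 0" for x
      using that by (simp add: f_def)
    then show ?thesis
      using exists_laplace_kernel[OF g(1)] pos[OF D] by simp
  qed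
  then obtain k\<^sub>0 where k\<^sub>0: "\<And>p x. p \<in> Delta \<Longrightarrow> borel_prob (k\<^sub>0 p x)"
    "\<And>p x \<theta>. p \<in> Delta \<Longrightarrow> \<theta> > 0 \<Longrightarrow> (\<integral>y. eexp y powr \<theta> \<partial>k\<^sub>0 p x) = eexp x powr f (fst p) (snd p) \<theta>"
    by metis
  define k where "k s t = k\<^sub>0 (s, t)" for s t
  have prob: "borel_prob (k s t x)" if "(s, t) \<in> Delta" for s t x
    using k\<^sub>0(1) that by (simp add: k_def)
  have lap: "(\<integral>y. eexp y powr \<theta> \<partial>k s t x) = eexp x powr f s t \<theta>" if "(s, t) \<in> Delta" "\<theta> > 0" for s t x \<theta>
    using k\<^sub>0(2)[OF that] by (simp add: k_def)
  have "branching_kernels k"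
    by (rule branching_kernels_of_laplace[OF v real pos prob lap])
  moreover have "laplace_relation k v"
    unfolding laplace_relation_alt
    by (auto simp: lap real exp_of_real exp_eq_eexp_powr[symmetric] simp flip: of_real_mult of_real_minus)
  moreover have "k' s t x = k s t x"
    if k': "branching_kernels k'" "laplace_relation k' v" and D: "(s, t) \<in> Delta" for k' s t x
  proof (rule measure_eqI_laplace[OF _ prob[OF D]])
    show "borel_prob (k' s t x)"
      using transition_kernel_prob branching_kernels_transition[OF k'(1) D] by blast
    show "(\<integral>y. eexp y powr \<theta> \<partial>k' s t x) = (\<integral>y. eexp y powr \<theta> \<partial>k s t x)" if "\<theta> > 0" for \<theta>
      using branching_laplace_all[OF k' D that real[OF D that] pos[OF D that]] lap[OF D that] by simp
  qed
  ultimately show ?thesis by blast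
qed

theorem mainTheorem1:
  shows "(\<forall>k v. branching_kernels k \<and> (\<forall>(s, t) \<in> Delta. ext_bernstein (v s t)) \<and>
            laplace_relation k v \<longrightarrow>
            top_rev_evolution_family RHP v \<and> (\<forall>(s, t) \<in> Delta. v s t \<in> BF))
       \<and> (\<forall>v. top_rev_evolution_family RHP v \<and> (\<forall>(s, t) \<in> Delta. v s t \<in> BF) \<longrightarrow>
            (\<exists>k. branching_kernels k \<and> laplace_relation k v \<and>
               (\<forall>k'. branching_kernels k' \<and> laplace_relation k' v \<longrightarrow>
                  (\<forall>(s, t) \<in> Delta. \<forall>x. k' s t x = k s t x))))"
proof (intro conjI allI impI, goal_cases)
  case (1 k v)
  then interpret branching_process k v by unfold_locales auto
  show ?case by (rule v_top_rev_evolution_family)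
next
  case (2 k v)
  then interpret branching_process k v by unfold_locales auto
  show ?case using v_in_BF by auto
next
  case (3 v)
  then show ?case by (intro exists_unique_branching_kernels) auto
qed

end
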